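(* Let $m\geq 1$ be an integer. All differential equations and identities below are understood to hold for all large $x$. 1. Let $f(x)$ be a solution to the linear homogeneous differential equation of order $m$ $$f(x)=\sum_{k=1}^m p_k(x) f^{(k)}(x),$$ such that, for $1\le k\le m-1$, either $p_k\equiv 0$ or $p_k\in\mathbf{X}^{(i_k)}$ strictly for some integer $i_k$, and $p_m\in\mathbf{X}^{(i_m)}$ strictly for some integer $i_m$. Let also $g\in\mathbf{X}^{(s)}$ strictly for some positive integer $s$, such that $\lim_{x\to\infty}g(x)=+\infty$. Then $\phi(x)\equiv f(g(x))$ satisfies a linear homogeneous differential equation of order $m$ of the form $$\phi(x)=\sum_{k=1}^m \pi_k(x)\phi^{(k)}(x),$$ where the $\pi_k$ are determined by the $p_k$ (and $g$) through $$\pi_m(x)=\frac{p_m(g(x))}{(g'(x))^m},\qquad \pi_k(x)=\frac{p_k(g(x))}{L_{k,k}(x)}-\sum_{n=k+1}^m \pi_n(x)\frac{L_{n,k}(x)}{L_{k,k}(x)},\quad k=m-1,m-2,\ldots,1,$$ with $L_{n,k}(x)=B_{n,k}(g'(x),g''(x),\ldots,g^{(n-k+1)}(x))$ and $B_{n,k}$ the partial Bell polynomials, and are such that, for $1\le k\le m-1$, either $\pi_k\equiv 0$ or $\pi_k\in\mathbf{X}^{(r_k)}$ strictly for some integer $r_k$, and $\pi_m\in\mathbf{X}^{(r_m)}$ strictly for some integer $r_m$. Actually, $$r_m=s(i_m-m)+m,$$ and, for $k=m-1,m-2,\ldots,2,1$, if $\pi_k\not\equiv 0$, $$r_k\le \max\{s(i_k-k),\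 r_{k+1}-(k+1),\ r_{k+2}-(k+2),\ldots,\ r_m-m\}+k,$$ where on the right-hand side the term $s(i_k-k)$ is absent when $p_k\equiv 0$, and the term $r_n-n$ is absent when $\pi_n\equiv 0$, for $n\in\{k+1,\ldots,m-1\}$. In addition, for each $k=1,\ldots,m$ with $\pi_k\not\equiv 0$, $$r_k\le \max_{\substack{k\le n\le m\\ p_n\not\equiv 0}}[s(i_n-n)]+k.$$ 2. Let $f(x)$ be in $\mathbf{B}^{(m)}$ and let $g(x)$ be in $\mathbf{X}^{(s)}$ strictly for some positive integer $s$, such that $\lim_{x\to\infty}g(x)=+\infty$. Then $\phi(x)\equiv f(g(x))$ is also in $\mathbf{B}^{(m)}$.
   Context: **The sets $\mathbf{A}^{(\gamma)}$.** For $\gamma$ complex in general, a function $\alpha(x)$ belongs to $\mathbf{A}^{(\gamma)}$ if it is infinitely differentiable for all large $x>0$ and has a Poincaré-type asymptotic expansion $\alpha(x)\sim\sum_{i=0}^\infty \alpha_i x^{\gamma-i}$ as $x\to\infty$, and its derivatives have Poincaré-type asymptotic expansions obtained by differentiating this one formally term by term. If $\alpha_0\ne 0$, then $\alpha$ is said to belong to $\mathbf{A}^{(\gamma)}$ strictly. If the asymptotic expansion is empty, i.e. $\alpha_i=0$ for all $i$ (so that either $\alpha\equiv 0$ or $\alpha(x)=O(x^{-\mu})$ as $x\to\infty$ for every $\mu>0$), we write $\alpha\sim 0$; otherwise $\alpha\not\sim 0$. **The subsets $\mathbf{X}^{(\gamma)}$.** These are subsets $\mathbf{X}^{(\gamma)}\subset\mathbf{A}^{(\gamma)}$,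 fixed for all $\gamma$ collectively, with the following properties: (i) if $\alpha\in\mathbf{X}^{(\gamma)}$, then either $\alpha\equiv 0$ or $\alpha\in\mathbf{A}^{(\gamma-k)}$ strictly for some nonnegative integer $k$ (thus for such functions $\alpha\sim 0\Leftrightarrow\alpha\equiv 0$); (ii) $\mathbf{X}^{(\gamma)}$ is closed under addition and multiplication by scalars; (iii) if $\alpha\in\mathbf{X}^{(\gamma)}$ and $\beta\in\mathbf{X}^{(\delta)}$, then $\alpha\beta\in\mathbf{X}^{(\gamma+\delta)}$; if, in addition, $\beta\in\mathbf{A}^{(\delta)}$ strictly, then $\alpha/\beta\in\mathbf{X}^{(\gamma-\delta)}$; (iv) if $\alpha\in\mathbf{X}^{(\gamma)}$, then $\alpha'\in\mathbf{X}^{(\gamma-1)}$. "$\alpha\in\mathbf{X}^{(\gamma)}$ strictly" means that $\alpha\in\mathbf{X}^{(\gamma)}$ and $\alpha\in\mathbf{A}^{(\gamma)}$ strictly. Standing convention on the family $\mathbf{X}^{(\gamma)}$ (the following elementary properties of the sets $\mathbf{A}^{(\gamma)}$ are used with $\mathbf{X}$ in place of $\mathbf{A}$): $\mathbf{X}^{(\gamma)}\supset\mathbf{X}^{(\gamma-1)}\supset\mathbf{X}^{(\gamma-2)}\supset\cdots$, and a function $\alpha\not\equiv 0$ in $\mathbf{X}^{(\gamma)}$, but not strictly, is in $\mathbf{X}^{(\gamma-k)}$ strictly for a unique positive integer $k$; and if $\alpha\in\mathbf{X}^{(\gamma)}$ strictly and $\beta\in\mathbf{X}^{(k)}$ strictly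 for some positive integer $k$, with $\beta(x)>0$ for all large $x$, then $\alpha(\beta(x))$ is in $\mathbf{X}^{(k\gamma)}$ strictly. **The class $\mathbf{B}^{(m)}$.** A function $f(x)$ that is infinitely differentiable for all large $x$ belongs to $\mathbf{B}^{(m)}$ if it satisfies a linear homogeneous ordinary differential equation of order $m$ of the form $f(x)=\sum_{k=1}^m p_k(x)f^{(k)}(x)$, where, for $1\le k\le m-1$, either $p_k\sim 0$ or $p_k\in\mathbf{A}^{(i_k)}$ strictly for some integer $i_k\le k$, and $p_m\in\mathbf{A}^{(i_m)}$ strictly for some integer $i_m\le m$. **Bell polynomials.** For $1\le k\le n$, $$B_{n,k}(y_1,\ldots,y_{n-k+1})=\sum\frac{n!}{\prod_{i=1}^{n-k+1}j_i!}\prod_{i=1}^{n-k+1}\left(\frac{y_i}{i!}\right)^{j_i},$$ the sum being over nonnegative integers $j_1,\ldots,j_{n-k+1}$ with $\sum_{i=1}^{n-k+1} j_i=k$ and $\sum_{i=1}^{n-k+1} i\,j_i=n$. In particular $B_{k,k}(y_1)=y_1^k$. *)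

theory Defs
  imports "HOL-Analysis.Analysis" "HOL-Library.Landau_Symbols"
begin

(* Functions of the real variable x are total functions on the reals, but only their
   behaviour for all large x matters; "identically zero" and all identities are read
   as holding eventually at infinity. *)

definition hderiv :: "nat \<Rightarrow> (real \<Rightarrow> 'a::real_normed_vector) \<Rightarrow> real \<Rightarrow> 'a" where
  "hderiv k f = ((\<lambda>h x. vector_derivative h (at x)) ^^ k) f"

definition smooth_at_top :: "(real \<Rightarrow> 'a::real_normed_vector) \<Rightarrow> bool" where
  "smooth_at_top f \<longleftrightarrow> (\<forall>\<^sub>F x in at_top. \<forall>k. hderiv k f differentiable (at x))"

definition ev_zero :: "(real \<Rightarrow> complex) \<Rightarrow> bool" where
  "ev_zero \<alpha> \<longleftrightarrow> (\<forall>\<^sub>F x in at_top. \<alpha> x = 0)"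

definition poincare :: "(real \<Rightarrow> complex) \<Rightarrow> complex \<Rightarrow> (nat \<Rightarrow> complex) \<Rightarrow> bool" where
  "poincare \<alpha> \<gamma> a \<longleftrightarrow>
     (\<forall>N. (\<lambda>x. \<alpha> x - (\<Sum>i<N. a i * of_real x powr (\<gamma> - of_nat i)))
            \<in> O[at_top](\<lambda>x. of_real x powr (\<gamma> - of_nat N)))"

(* The factor (\<gamma> - i) (\<gamma> - i - 1) ... (\<gamma> - i - k + 1) comes from differentiating
   x powr (\<gamma> - i) formally k times. *)
definition has_expansion :: "(real \<Rightarrow> complex) \<Rightarrow> complex \<Rightarrow> (nat \<Rightarrow> complex) \<Rightarrow> bool" where
  "has_expansion \<alpha> \<gamma> a \<longleftrightarrow>
     smooth_at_top \<alpha> \<and>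
     (\<forall>k. poincare (hderiv k \<alpha>) (\<gamma> - of_nat k)
            (\<lambda>i. a i * (\<Prod>j<k. \<gamma> - of_nat i - of_nat j)))"

definition class_A :: "complex \<Rightarrow> (real \<Rightarrow> complex) set" where
  "class_A \<gamma> = {\<alpha>. \<exists>a. has_expansion \<alpha> \<gamma> a}"

definition strict_A :: "complex \<Rightarrow> (real \<Rightarrow> complex) set" where
  "strict_A \<gamma> = {\<alpha>. \<exists>a. has_expansion \<alpha> \<gamma> a \<and> a 0 \<noteq> 0}"

(* The relation \<alpha> \<sim> 0.  With all coefficients zero the choice of \<gamma> is immaterial. *)
definition empty_expansion :: "(real \<Rightarrow> complex) \<Rightarrow> bool" where
  "empty_expansion \<alpha> \<longleftrightarrow> (\<exists>\<gamma>. has_expansion \<alpha> \<gamma> (\<lambda>_. 0))"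

definition strict_X ::
  "(complex \<Rightarrow> (real \<Rightarrow> complex) set) \<Rightarrow> complex \<Rightarrow> (real \<Rightarrow> complex) set" where
  "strict_X X \<gamma> = X \<gamma> \<inter> strict_A \<gamma>"

(* Assumption germ makes explicit that members of X are only considered for large x;
   without it, quotients and derivatives of total functions would depend on the
   values assigned where they are undefined. *)
locale X_family =
  fixes X :: "complex \<Rightarrow> (real \<Rightarrow> complex) set"
  assumes subset_A: "X \<gamma> \<subseteq> class_A \<gamma>"
    and germ: "\<lbrakk>\<alpha> \<in> X \<gamma>; \<forall>\<^sub>F x in at_top. \<alpha> x = \<beta> x\<rbrakk> \<Longrightarrow> \<beta> \<in> X \<gamma>"
    and zero_or_strict: "\<alpha> \<in> X \<gamma> \<Longrightarrow> ev_zero \<alpha> \<or> (\<exists>k::nat. \<alpha> \<in> strict_A (\<gamma> - of_nat k))"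
    and add: "\<lbrakk>\<alpha> \<in> X \<gamma>; \<beta> \<in> X \<gamma>\<rbrakk> \<Longrightarrow> (\<lambda>x. \<alpha> x + \<beta> x) \<in> X \<gamma>"
    and scale: "\<alpha> \<in> X \<gamma> \<Longrightarrow> (\<lambda>x. c * \<alpha> x) \<in> X \<gamma>"
    and mult: "\<lbrakk>\<alpha> \<in> X \<gamma>; \<beta> \<in> X \<delta>\<rbrakk> \<Longrightarrow> (\<lambda>x. \<alpha> x * \<beta> x) \<in> X (\<gamma> + \<delta>)"
    and divide: "\<lbrakk>\<alpha> \<in> X \<gamma>; \<beta> \<in> X \<delta>; \<beta> \<in> strict_A \<delta>\<rbrakk> \<Longrightarrow> (\<lambda>x. \<alpha> x / \<beta> x) \<in> X (\<gamma> - \<delta>)"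
    and deriv: "\<alpha> \<in> X \<gamma> \<Longrightarrow> hderiv 1 \<alpha> \<in> X (\<gamma> - 1)"
    and nested: "X (\<gamma> - 1) \<subseteq> X \<gamma>"
    and strict_lower: "\<lbrakk>\<alpha> \<in> X \<gamma>; \<not> ev_zero \<alpha>; \<alpha> \<notin> strict_X X \<gamma>\<rbrakk>
          \<Longrightarrow> \<exists>!k::nat. k > 0 \<and> \<alpha> \<in> strict_X X (\<gamma> - of_nat k)"
    and compose: "\<And>\<alpha> (\<beta> :: real \<Rightarrow> real) (k::nat) \<gamma>.
          \<lbrakk>\<alpha> \<in> strict_X X \<gamma>; k > 0; (\<lambda>x. of_real (\<beta> x)) \<in> strict_X X (of_nat k);
           \<forall>\<^sub>F x in at_top. \<beta> x > 0\<rbrakk>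
          \<Longrightarrow> (\<lambda>x. \<alpha> (\<beta> x)) \<in> strict_X X (of_nat k * \<gamma>)"

definition solves_ode :: "nat \<Rightarrow> (nat \<Rightarrow> real \<Rightarrow> complex) \<Rightarrow> (real \<Rightarrow> complex) \<Rightarrow> bool" where
  "solves_ode m p f \<longleftrightarrow>
     (\<forall>\<^sub>F x in at_top. (\<forall>k<m. hderiv k f differentiable (at x)) \<and>
        f x = (\<Sum>k=1..m. p k x * hderiv k f x))"

definition class_B :: "nat \<Rightarrow> (real \<Rightarrow> complex) set" where
  "class_B m = {f. smooth_at_top f \<and>
     (\<exists>p. solves_ode m p f \<and>
        (\<forall>k\<in>{1..<m}. empty_expansion (p k) \<or> (\<exists>i::int. i \<le> int k \<and> p k \<in> strict_A (of_int i))) \<and>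
        (\<exists>i::int. i \<le> int m \<and> p m \<in> strict_A (of_int i)))}"

definition bell_index :: "nat \<Rightarrow> nat \<Rightarrow> (nat \<Rightarrow> nat) set" where
  "bell_index n k = {j \<in> {1..n-k+1} \<rightarrow>\<^sub>E UNIV.
     (\<Sum>i=1..n-k+1. j i) = k \<and> (\<Sum>i=1..n-k+1. i * j i) = n}"

lemma finite_bell_index: "finite (bell_index n k)"
proof (rule finite_subset)
  show "bell_index n k \<subseteq> {1..n-k+1} \<rightarrow>\<^sub>E {..k}"
  proof
    fix j assume j: "j \<in> bell_index n k"
    have "j i \<le> k" if "i \<in> {1..n-k+1}" for i
      using j member_le_sum[of i "{1..n-k+1}" j] that by (auto simp: bell_index_def)
    with j show "j \<in> {1..n-k+1} \<rightarrow>\<^sub>E {..k}"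
      by (auto simp: bell_index_def PiE_iff)
  qed
qed (simp add: finite_PiE)

(* Partial Bell polynomial for 1 \<le> k \<le> n; the argument y 0 is not used. *)
definition bell :: "nat \<Rightarrow> nat \<Rightarrow> (nat \<Rightarrow> complex) \<Rightarrow> complex" where
  "bell n k y = (\<Sum>j\<in>bell_index n k.
     fact n / (\<Prod>i=1..n-k+1. fact (j i)) * (\<Prod>i=1..n-k+1. (y i / fact i) ^ j i))"

definition bell_deriv :: "(real \<Rightarrow> real) \<Rightarrow> nat \<Rightarrow> nat \<Rightarrow> real \<Rightarrow> complex" where
  "bell_deriv g n k x = bell n k (\<lambda>i. of_real (hderiv i g x))"

end

theory Submission
  imports Defs "HOL-Analysis.Analysis"
begin

text \<open>
  Faa di Bruno's formula expresses the derivatives of \<open>f \<circ> g\<close> through the functions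
  \<open>f\<^sup>(\<^sup>k\<^sup>) \<circ> g\<close> by the triangular matrix \<open>L\<^sub>n\<^sub>,\<^sub>k\<close>, whose diagonal entries are powers of \<open>g'\<close>. Inverting it by
  back substitution produces the \<open>\<pi>\<^sub>k\<close>. The recurrence
  \<open>L\<^sub>n\<^sub>+\<^sub>1\<^sub>,\<^sub>k = L\<^sub>n\<^sub>,\<^sub>k' + g' L\<^sub>n\<^sub>,\<^sub>k\<^sub>-\<^sub>1\<close> shows that \<open>L\<^sub>n\<^sub>,\<^sub>k\<close> has order at most \<open>sk - n\<close>, and the bounds on the
  orders are then a matter of degree counting, valid in any family of functions graded by integer
  orders that is closed under sums, products and differentiation. Both parts of the theorem are
  instances: the family \<open>X\<close>, and the functions with an asymptotic expansion in integer powers. The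
  latter is closed under products, inverses and compositions because a function has an expansion iff,
  after removing any number of leading terms, it is a symbol (each differentiation lowers its order by one);
  this allows induction on the number of terms.
\<close>

section \<open>Iterated derivatives and symbol classes\<close>

text \<open>What has to be counted is the excess of order over index. If \<open>p_n(g)\<close> has
  order at most \<open>D + s n\<close> for all n from k on, then \<open>\<pi>_n\<close> has order at
  most \<open>D + n\<close>, because \<open>L_{l,n} / L_{n,n}\<close> has order at most
  \<open>n - l\<close> whatever s is. Each inequality for \<open>r_k\<close> is one choice of D, and
  class B is the choice D = 0. The obstacle is cancellation: sums can lose leading terms, so
  strictness does not pass through the recursion. Orders are therefore carried as upper bounds, and
  the true order is recovered at the end from the dichotomy "zero, or strict of some lower order".
  Only \<open>\<pi>_m\<close> is a single quotient, hence the exact value of \<open>r_m\<close>. Two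
  families are needed because a coefficient in class B may have an empty expansion without
  vanishing, which is impossible in X. Division by \<open>L_{k,k}\<close> requires g' to be strict
  of order s - 1; its leading coefficient is s times that of g, and this is where s > 0
  enters.\<close>

abbreviation vd :: "(real \<Rightarrow> 'a::real_normed_vector) \<Rightarrow> real \<Rightarrow> 'a" where
  "vd f \<equiv> (\<lambda>x. vector_derivative f (at x))"

lemma hderiv_0 [simp]: "hderiv 0 f = f"
  by (simp add: hderiv_def)

lemma hderiv_Suc: "hderiv (Suc k) f = vd (hderiv k f)"
  by (simp add: hderiv_def)

lemma hderiv_Suc_vd: "hderiv (Suc k) f = hderiv k (vd f)"
  unfolding hderiv_def by (simp add: funpow_Suc_right del: funpow.simps)

lemma hderiv_1 [simp]: "hderiv (Suc 0) f = vd f"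
  by (simp add: hderiv_Suc)

lemma vector_derivative_has:
  "f differentiable at x \<Longrightarrow> (f has_vector_derivative vd f x) (at x)"
  by (simp add: vector_derivative_works)

text \<open>A derivative depends on the function near the point, so identities are kept on an
  explicit open half-line; one threshold then survives any number of differentiations.\<close>

lemma vd_transform:
  assumes "\<And>y. y > b \<Longrightarrow> f y = g y" "x > (b::real)"
  shows "vd f x = vd g x"
  using assms
  by (intro vector_derivative_cong_eq)
     (auto simp: eventually_nhds intro!: exI[of _ "{b<..}"])

lemma differentiable_transform:
  assumes "f differentiable at x" "\<And>y. y > b \<Longrightarrow> f y = g y" "x > (b::real)"
  shows "g differentiable at x"
  using has_vector_derivative_transform_within_open[OF vector_derivative_has[OF assms(1)], of "{b<..}" g] assms
  by (auto intro: differentiableI_vector)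

section \<open>Smoothness for large x and the passage between real and complex values\<close>

lemma smooth_at_top_iff:
  "smooth_at_top f \<longleftrightarrow> (\<exists>b. \<forall>x>b. \<forall>k. hderiv k f differentiable at x)"
  by (simp add: smooth_at_top_def eventually_at_top_dense)

lemma vd_of_real:
  assumes "g differentiable at x"
  shows "((\<lambda>x. complex_of_real (g x)) has_vector_derivative of_real (vd g x)) (at x)"
  using bounded_linear.has_vector_derivative[OF bounded_linear_of_real vector_derivative_has[OF assms]] .

lemma vd_Re:
  assumes "(f has_vector_derivative D) (at x)"
  shows "((\<lambda>x. Re (f x)) has_vector_derivative Re D) (at x)"
  using bounded_linear.has_vector_derivative[OF bounded_linear_Re assms] .

text \<open>Smoothness is known only for the complexified \<open>g\<close>. Taking real parts brings
  differentiability back to \<open>g\<close>; it is proved together with the identity of the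
  derivatives, since the induction step uses both.\<close>

lemma hderiv_of_real_aux:
  assumes "\<And>x k. x > b \<Longrightarrow> hderiv k (\<lambda>x. complex_of_real (g x)) differentiable at x" "x > b"
  shows "hderiv k g differentiable at x \<and> hderiv k (\<lambda>x. complex_of_real (g x)) x = of_real (hderiv k g x)"
  using assms(2)
proof (induction k arbitrary: x)
  case 0
  have "((\<lambda>x. Re (complex_of_real (g x))) has_vector_derivative Re (vd (\<lambda>x. complex_of_real (g x)) x)) (at x)"
    using assms(1)[of x 0] 0 by (intro vd_Re vector_derivative_has) auto
  then show ?case by (auto intro: differentiableI_vector)
next
  case (Suc k)
  let ?G = "\<lambda>x. complex_of_real (g x)"
  have "vd (hderiv k ?G) y = of_real (vd (hderiv k g) y)" if "y > b" for y
    using vector_derivative_at[OF vd_of_real[of "hderiv k g" y]] Suc.IH that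
      vd_transform[of b "hderiv k ?G" "\<lambda>y. of_real (hderiv k g y)" y] by simp
  then have eq: "hderiv (Suc k) ?G y = of_real (hderiv (Suc k) g y)" if "y > b" for y
    using that by (simp add: hderiv_Suc)
  have "((\<lambda>x. Re (hderiv (Suc k) ?G x)) has_vector_derivative Re (vd (hderiv (Suc k) ?G) x)) (at x)"
    using assms(1)[of x "Suc k"] Suc.prems by (intro vd_Re vector_derivative_has) auto
  then have "(\<lambda>x. Re (hderiv (Suc k) ?G x)) differentiable at x"
    by (rule differentiableI_vector)
  then have "hderiv (Suc k) g differentiable at x"
    by (rule differentiable_transform[of _ _ b]) (use eq Suc.prems in auto)
  with eq Suc.prems show ?case by auto
qed

lemma smooth_at_top_of_real:
  assumes "smooth_at_top (\<lambda>x. complex_of_real (g x))"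
  shows "\<exists>b. \<forall>x>b. \<forall>k. hderiv k g differentiable at x \<and>
     hderiv k (\<lambda>x. complex_of_real (g x)) x = of_real (hderiv k g x)"
  using assms hderiv_of_real_aux[of _ g] unfolding smooth_at_top_iff by metis

text \<open>Only integer orders occur from here on. Integer powers involve no choice of branch and
  obey the exponent laws away from zero; \<open>powr_eq_pw\<close> leads back to
  \<open>powr\<close>.\<close>

definition pw :: "int \<Rightarrow> real \<Rightarrow> complex" where
  "pw d x = of_real x powi d"

text \<open>Classical symbols of order \<open>d\<close>, cut off at \<open>n\<close> derivatives so
  that closure properties go by induction on \<open>n\<close>. Differentiability is asked of the
  derivatives of order below \<open>n\<close>, the growth bound also of the
  \<open>n\<close>-th.\<close>

primrec symbol_upto :: "nat \<Rightarrow> real \<Rightarrow> int \<Rightarrow> (real \<Rightarrow> complex) \<Rightarrow> bool" where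
  "symbol_upto 0 b d f \<longleftrightarrow> f \<in> O[at_top](pw d)"
| "symbol_upto (Suc n) b d f \<longleftrightarrow>
     (\<forall>x>b. f differentiable at x) \<and> f \<in> O[at_top](pw d) \<and> symbol_upto n b (d - 1) (vd f)"

text \<open>One threshold serves all orders, since \<open>smooth_at_top\<close> demands a common neighbourhood of
  infinity for all derivatives.\<close>

definition symbol :: "int \<Rightarrow> (real \<Rightarrow> complex) \<Rightarrow> bool" where
  "symbol d f \<longleftrightarrow> (\<exists>b. \<forall>n. symbol_upto n b d f)"

lemma pw_nonzero: "x > 0 \<Longrightarrow> pw d x \<noteq> 0"
  by (simp add: pw_def)

lemma eventually_pw_nonzero: "\<forall>\<^sub>F x in at_top. pw d x \<noteq> 0"
  using eventually_gt_at_top[of 0] by eventually_elim (rule pw_nonzero)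

lemma pw_add: "x > 0 \<Longrightarrow> pw (d + e) x = pw d x * pw e x"
  by (simp add: pw_def power_int_add)

lemma bigo_pw_mult:
  assumes "f \<in> O[at_top](pw d)" "g \<in> O[at_top](pw e)"
  shows "(\<lambda>x. f x * g x) \<in> O[at_top](pw (d + e))"
proof -
  have "(\<lambda>x. f x * g x) \<in> O[at_top](\<lambda>x. pw d x * pw e x)"
    using assms by (rule landau_o.big.mult)
  also have "(\<lambda>x. pw d x * pw e x) \<in> \<Theta>[at_top](pw (d + e))"
    by (intro bigthetaI_cong eventually_mono[OF eventually_gt_at_top[of 0]]) (simp add: pw_add)
  finally show ?thesis .
qed

lemma pw_mono_bigo:
  assumes "d \<le> e" shows "pw d \<in> O[at_top](pw e)"
proof (rule bigoI[of _ 1])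
  show "\<forall>\<^sub>F x in at_top. norm (pw d x) \<le> 1 * norm (pw e x)"
    using eventually_ge_at_top[of 1]
    by eventually_elim (use assms in \<open>auto simp: pw_def norm_power_int intro!: power_int_increasing\<close>)
qed

lemma bigo_pw_mono: "f \<in> O[at_top](pw d) \<Longrightarrow> d \<le> e \<Longrightarrow> f \<in> O[at_top](pw e)"
  using landau_o.big.trans pw_mono_bigo by blast

lemma pw_has_vector_derivative:
  assumes "x > 0"
  shows "(pw d has_vector_derivative of_int d * pw (d - 1) x) (at x)"
proof -
  have "((\<lambda>z. z powi d) has_field_derivative of_int d * pw (d - 1) x) (at (complex_of_real x))"
    using assms unfolding pw_def
    by (auto intro!: derivative_eq_intros)
  from field_vector_diff_chain_at[OF has_vector_derivative_of_real[of "\<lambda>x. x" 1] this]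
  show ?thesis by (simp add: o_def pw_def[abs_def] has_vector_derivative_id[unfolded id_def])
qed

lemma vector_derivative_eqs:
  assumes "f differentiable at x" "g differentiable at x"
  shows "vd (\<lambda>x. f x + g x) x = vd f x + vd g x"
    and "vd (\<lambda>x. f x * g x) x = f x * vd g x + vd f x * (g x :: complex)"
    and "vd (\<lambda>x. c * g x) x = c * vd g x"
    and "g x \<noteq> 0 \<Longrightarrow> vd (\<lambda>x. inverse (g x)) x = (- vd g x) * inverse (g x) * inverse (g x)"
proof -
  note d = vector_derivative_has[OF assms(1)] vector_derivative_has[OF assms(2)]
  show "vd (\<lambda>x. f x + g x) x = vd f x + vd g x"
    by (rule vector_derivative_at has_vector_derivative_add d)+
  show "vd (\<lambda>x. f x * g x) x = f x * vd g x + vd f x * g x"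
    by (rule vector_derivative_at has_vector_derivative_mult d)+
  show "vd (\<lambda>x. c * g x) x = c * vd g x"
    by (rule vector_derivative_at has_vector_derivative_mult_right d)+
  assume "g x \<noteq> 0"
  then have "(inverse has_field_derivative - (inverse (g x) * inverse (g x))) (at (g x))"
    by (auto intro!: derivative_eq_intros)
  from vector_derivative_at[OF field_vector_diff_chain_at[OF d(2) this]]
  show "vd (\<lambda>x. inverse (g x)) x = (- vd g x) * inverse (g x) * inverse (g x)"
    by (simp add: o_def)
qed

lemma symbol_upto_bigo: "symbol_upto n b d f \<Longrightarrow> f \<in> O[at_top](pw d)"
  by (cases n) auto

lemma symbol_upto_cong:
  assumes "symbol_upto n b d f" "\<And>x. x > b \<Longrightarrow> f x = g x"
  shows "symbol_upto n b d g"
  using assms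
proof (induction n arbitrary: d f g)
  case 0
  have "\<forall>\<^sub>F x in at_top. f x = g x" using 0 by (auto simp: eventually_at_top_dense)
  with 0 landau_o.big.in_cong[of f g at_top] show ?case by simp
next
  case (Suc n)
  have "\<forall>\<^sub>F x in at_top. f x = g x" using Suc.prems by (auto simp: eventually_at_top_dense)
  moreover have "symbol_upto n b (d - 1) (vd g)"
  proof (rule Suc.IH)
    show "symbol_upto n b (d - 1) (vd f)" using Suc.prems(1) by simp
    show "vd f x = vd g x" if "x > b" for x
      using Suc.prems(2) that by (rule vd_transform)
  qed
  moreover have "g differentiable at x" if "x > b" for x
  proof (rule differentiable_transform)
    show "f differentiable at x" using Suc.prems(1) that by simp
  qed (use Suc.prems(2) that in blast)+
  ultimately show ?case using Suc.prems landau_o.big.in_cong[of f g at_top] by simp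
qed

lemma symbol_upto_Suc: "symbol_upto (Suc n) b d f \<Longrightarrow> symbol_upto n b d f"
  by (induction n arbitrary: d f) auto

lemma symbol_upto_mono_threshold: "symbol_upto n b d f \<Longrightarrow> b \<le> c \<Longrightarrow> symbol_upto n c d f"
  by (induction n arbitrary: d f) auto

lemma symbol_upto_mono: "symbol_upto n b d f \<Longrightarrow> d \<le> e \<Longrightarrow> symbol_upto n b e f"
proof (induction n arbitrary: d e f)
  case (Suc n)
  from Suc.prems Suc.IH[of "d - 1" "vd f" "e - 1"] show ?case by (auto intro: bigo_pw_mono)
qed (auto intro: bigo_pw_mono)

lemma symbol_upto_zero: "symbol_upto n b d (\<lambda>x. 0)"
  by (induction n arbitrary: d) auto

lemma symbol_upto_add:
  "symbol_upto n b d f \<Longrightarrow> symbol_upto n b d g \<Longrightarrow> symbol_upto n b d (\<lambda>x. f x + g x)"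
proof (induction n arbitrary: d f g)
  case (Suc n)
  then have "symbol_upto n b (d - 1) (\<lambda>x. vd f x + vd g x)" by auto
  then have "symbol_upto n b (d - 1) (vd (\<lambda>x. f x + g x))"
    by (rule symbol_upto_cong) (use Suc.prems in \<open>simp add: vector_derivative_eqs\<close>)
  then show ?case using Suc.prems by (simp add: sum_in_bigo)
qed (simp add: sum_in_bigo)

text \<open>Both terms of the product rule have order \<open>d + e - 1\<close>. The undifferentiated
  factor is only needed to level \<open>n\<close>, hence \<open>symbol_upto_Suc\<close>.\<close>

lemma symbol_upto_mult:
  "symbol_upto n b d f \<Longrightarrow> symbol_upto n b e g \<Longrightarrow> symbol_upto n b (d + e) (\<lambda>x. f x * g x)"
proof (induction n arbitrary: d e f g)
  case (Suc n)
  have "symbol_upto n b (d + (e - 1)) (\<lambda>x. f x * vd g x)"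
       "symbol_upto n b (d - 1 + e) (\<lambda>x. vd f x * g x)"
    using Suc.prems symbol_upto_Suc[OF Suc.prems(1)] symbol_upto_Suc[OF Suc.prems(2)]
    by (auto intro!: Suc.IH)
  then have "symbol_upto n b (d + e - 1) (\<lambda>x. f x * vd g x + vd f x * g x)"
    by (intro symbol_upto_add) (simp_all add: algebra_simps)
  then have "symbol_upto n b (d + e - 1) (vd (\<lambda>x. f x * g x))"
    by (rule symbol_upto_cong) (use Suc.prems in \<open>auto simp: vector_derivative_eqs\<close>)
  then show ?case using Suc.prems by (auto intro: bigo_pw_mult)
qed (auto intro: bigo_pw_mult)

lemma symbol_upto_pw: "b \<ge> 0 \<Longrightarrow> symbol_upto n b d (\<lambda>x. c * pw d x)"
proof (induction n arbitrary: d c)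
  case (Suc n)
  have der: "((\<lambda>x. c * pw d x) has_vector_derivative c * (of_int d * pw (d - 1) x)) (at x)" if "x > b" for x
    using that Suc.prems by (intro has_vector_derivative_mult_right pw_has_vector_derivative) auto
  have "symbol_upto n b (d - 1) (\<lambda>x. (c * of_int d) * pw (d - 1) x)"
    using Suc by blast
  then have "symbol_upto n b (d - 1) (vd (\<lambda>x. c * pw d x))"
    by (rule symbol_upto_cong) (use vector_derivative_at[OF der] in \<open>auto simp: mult_ac\<close>)
  moreover have "(\<lambda>x. c * pw d x) differentiable at x" if "x > b" for x
    using der[OF that] by (rule differentiableI_vector)
  ultimately show ?case by simp
qed auto

lemma symbol_upto_minus: "symbol_upto n b d f \<Longrightarrow> symbol_upto n b d (\<lambda>x. - f x)"
proof (induction n arbitrary: d f)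
  case (Suc n)
  then have "symbol_upto n b (d - 1) (\<lambda>x. - vd f x)" by auto
  then have "symbol_upto n b (d - 1) (vd (\<lambda>x. - f x))"
    by (rule symbol_upto_cong)
       (use Suc.prems in \<open>auto intro!: vector_derivative_at[symmetric] has_vector_derivative_minus vector_derivative_has\<close>)
  then show ?case using Suc.prems by auto
qed auto

text \<open>The derivative \<open>- f' / f^2\<close> contains \<open>1 / f\<close> again, so level
  \<open>n\<close> of the statement feeds level \<open>n + 1\<close>; the orders add up to
  \<open>(d - 1) - 2 d\<close>. Nonvanishing and the bound on \<open>1 / f\<close> itself have to
  come from outside.\<close>

lemma symbol_upto_inverse:
  assumes "\<And>x. x > b \<Longrightarrow> f x \<noteq> 0" "(\<lambda>x. inverse (f x)) \<in> O[at_top](pw (- d))"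
  shows "symbol_upto n b d f \<Longrightarrow> symbol_upto n b (- d) (\<lambda>x. inverse (f x))"
proof (induction n)
  case (Suc n)
  have "symbol_upto n b ((d - 1 + - d) + - d) (\<lambda>x. vd f x * inverse (f x) * inverse (f x))"
    using Suc symbol_upto_Suc[OF Suc.prems]  by (intro symbol_upto_mult) auto
  then have "symbol_upto n b (- d - 1) (\<lambda>x. - (vd f x * inverse (f x) * inverse (f x)))"
    by (intro symbol_upto_minus) (simp add: minus_diff_commute)
  then have "symbol_upto n b (- d - 1) (vd (\<lambda>x. inverse (f x)))"
    by (rule symbol_upto_cong) (use Suc.prems assms in \<open>auto simp: vector_derivative_eqs\<close>)
  then show ?case using Suc.prems assms by (auto intro: )
qed (use assms in auto)

text \<open>In the chain rule \<open>g'\<close> has order \<open>s - 1\<close> and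
  \<open>f'(g)\<close> has order \<open>s (d - 1)\<close>, together \<open>s d - 1\<close>. The
  condition on powers of \<open>g\<close> is stated for all \<open>d\<close> because the induction
  lowers \<open>d\<close>; for negative \<open>d\<close> it amounts to a lower bound on
  \<open>g\<close>.\<close>

lemma symbol_upto_compose:
  assumes g: "\<And>x. x > b' \<Longrightarrow> g x > b" "filterlim g at_top at_top"
    and s: "\<And>d. (\<lambda>x. pw d (g x)) \<in> O[at_top](pw (s * d))"
  shows "symbol_upto n b d f \<Longrightarrow> (\<And>x. x > b' \<Longrightarrow> g differentiable at x) \<Longrightarrow>
    symbol_upto n b' (s - 1) (\<lambda>x. of_real (vd g x)) \<Longrightarrow>
    symbol_upto n b' (s * d) (\<lambda>x. f (g x))"
proof (induction n arbitrary: d f)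
  case 0
  then show ?case using landau_o.big.compose[OF _ g(2), of f "pw d"] landau_o.big_trans[OF _ s] by auto
next
  case (Suc n)
  have der: "((\<lambda>x. f (g x)) has_vector_derivative of_real (vd g x) * vd f (g x)) (at x)" if "x > b'" for x
    using vector_diff_chain_at[OF vector_derivative_has[of g x] vector_derivative_has[of f "g x"]] Suc.prems g that
    by (auto simp: o_def scaleR_conv_of_real)
  have "symbol_upto n b' (s - 1 + s * (d - 1)) (\<lambda>x. of_real (vd g x) * vd f (g x))"
    using Suc.prems symbol_upto_Suc by (intro symbol_upto_mult Suc.IH) auto
  then have "symbol_upto n b' (s * d - 1) (\<lambda>x. of_real (vd g x) * vd f (g x))"
    by (simp add: algebra_simps)
  then have "symbol_upto n b' (s * d - 1) (vd (\<lambda>x. f (g x)))"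
    by (rule symbol_upto_cong) (rule vector_derivative_at[OF der, symmetric])
  moreover have "(\<lambda>x. f (g x)) \<in> O[at_top](pw (s * d))"
    using Suc.prems landau_o.big.compose[OF _ g(2), of f "pw d"] landau_o.big_trans[OF _ s] by auto
  moreover have "(\<lambda>x. f (g x)) differentiable at x" if "x > b'" for x
    using der[OF that] by (rule differentiableI_vector)
  ultimately show ?case by simp
qed

section \<open>Symbol classes with the threshold hidden\<close>

lemma symbol_cong:
  assumes "symbol d f" "\<forall>\<^sub>F x in at_top. f x = g x"
  shows "symbol d g"
proof -
  obtain b where b: "\<And>n. symbol_upto n b d f" using assms(1) by (auto simp: symbol_def)
  obtain c where c: "\<And>x. x > c \<Longrightarrow> f x = g x" using assms(2) by (auto simp: eventually_at_top_dense)
  have "symbol_upto n (max b c) d g" for n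
    using symbol_upto_mono_threshold[OF b, of "max b c" n] by (rule symbol_upto_cong) (auto simp: c)
  then show ?thesis by (auto simp: symbol_def)
qed

lemma symbol_common_threshold:
  assumes "symbol d f" "symbol e g"
  obtains b where "\<And>n. symbol_upto n b d f" "\<And>n. symbol_upto n b e g"
proof -
  obtain a b where "\<And>n. symbol_upto n a d f" "\<And>n. symbol_upto n b e g"
    using assms by (auto simp: symbol_def)
  then show ?thesis
    by (intro that[of "max a b"])
       (auto intro: symbol_upto_mono_threshold[of _ a] symbol_upto_mono_threshold[of _ b])
qed

lemma symbol_bigo: "symbol d f \<Longrightarrow> f \<in> O[at_top](pw d)"
  by (auto simp: symbol_def intro: symbol_upto_bigo)

lemma symbol_mono: "symbol d f \<Longrightarrow> d \<le> e \<Longrightarrow> symbol e f"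
  by (auto simp: symbol_def intro: symbol_upto_mono)

lemma symbol_pw: "symbol d (\<lambda>x. c * pw d x)"
  by (auto simp: symbol_def intro: symbol_upto_pw)

lemma symbol_zero: "symbol d (\<lambda>x. 0)"
  by (auto simp: symbol_def intro: symbol_upto_zero)

lemma symbol_add: "symbol d f \<Longrightarrow> symbol d g \<Longrightarrow> symbol d (\<lambda>x. f x + g x)"
  by (erule (1) symbol_common_threshold) (auto simp: symbol_def intro!: symbol_upto_add)

lemma symbol_mult: "symbol d f \<Longrightarrow> symbol e g \<Longrightarrow> symbol (d + e) (\<lambda>x. f x * g x)"
  by (erule (1) symbol_common_threshold) (auto simp: symbol_def intro!: symbol_upto_mult)

lemma symbol_differentiable: "symbol d f \<Longrightarrow> \<forall>\<^sub>F x in at_top. f differentiable at x"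
  unfolding symbol_def eventually_at_top_dense by (metis symbol_upto.simps(2))

lemma symbol_vd: "symbol d f \<Longrightarrow> symbol (d - 1) (vd f)"
  unfolding symbol_def by (metis symbol_upto.simps(2))

lemma symbol_upto_iff:
  "symbol_upto n b d f \<longleftrightarrow> (\<forall>k<n. \<forall>x>b. hderiv k f differentiable at x) \<and>
     (\<forall>k<Suc n. hderiv k f \<in> O[at_top](pw (d - int k)))"
proof (induction n arbitrary: d f)
  case (Suc n)
  show ?case
    unfolding All_less_Suc2[of "Suc n"] All_less_Suc2[of n "\<lambda>k. \<forall>x>b. hderiv k f differentiable at x"]
      hderiv_Suc_vd symbol_upto.simps Suc.IH by (auto simp: algebra_simps)
qed auto

text \<open>Since one threshold serves all \<open>n\<close>, the quantifier over \<open>n\<close>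
  moves inside and the truncated classes become the derivative bounds that
  \<open>has_expansion\<close> speaks of.\<close>

lemma symbol_iff:
  "symbol d f \<longleftrightarrow> smooth_at_top f \<and> (\<forall>k. hderiv k f \<in> O[at_top](pw (d - int k)))"
  unfolding symbol_def smooth_at_top_iff symbol_upto_iff by (auto simp: less_Suc_eq)

text \<open>The value \<open>c = 0\<close> is allowed and says that \<open>f\<close> is of smaller
  order than x^d; strictness is \<open>c \<noteq> 0\<close>. Being a limit, \<open>c\<close> is
  unique, which later glues coefficients together.\<close>

definition leading :: "int \<Rightarrow> (real \<Rightarrow> complex) \<Rightarrow> complex \<Rightarrow> bool" where
  "leading d f c \<longleftrightarrow> ((\<lambda>x. f x / pw d x) \<longlongrightarrow> c) at_top"

lemma leading_unique: "leading d f c \<Longrightarrow> leading d f c' \<Longrightarrow> c = c'"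
  unfolding leading_def by (rule tendsto_unique[OF trivial_limit_at_top_linorder])

lemma leading_cong: "leading d f c \<Longrightarrow> \<forall>\<^sub>F x in at_top. f x = g x \<Longrightarrow> leading d g c"
  unfolding leading_def by (erule Lim_transform_eventually) (auto elim: eventually_mono)

lemma leading_bigtheta: "leading d f c \<Longrightarrow> c \<noteq> 0 \<Longrightarrow> f \<in> \<Theta>[at_top](pw d)"
  unfolding leading_def by (rule bigthetaI_tendsto_norm[of "norm c"]) (auto intro: tendsto_norm)

lemma leading_nonzero: "leading d f c \<Longrightarrow> c \<noteq> 0 \<Longrightarrow> \<forall>\<^sub>F x in at_top. f x \<noteq> 0"
  using eventually_nonzero_bigtheta[OF leading_bigtheta] eventually_pw_nonzero by blast

lemma leading_mult: "leading d f c \<Longrightarrow> leading e g c' \<Longrightarrow> leading (d + e) (\<lambda>x. f x * g x) (c * c')"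
  unfolding leading_def
  by (rule Lim_transform_eventually, erule (1) tendsto_mult,
      rule eventually_mono[OF eventually_gt_at_top[of 0]]) (simp add: pw_add)

lemma pw_minus: "pw (- d) x = inverse (pw d x)"
  by (simp add: pw_def power_int_minus)

lemma leading_inverse: "leading d f c \<Longrightarrow> c \<noteq> 0 \<Longrightarrow> leading (- d) (\<lambda>x. inverse (f x)) (inverse c)"
  unfolding leading_def by (drule (1) tendsto_inverse) (simp add: pw_minus divide_simps)

lemma pw_0 [simp]: "pw 0 = (\<lambda>x. 1)"
  by (simp add: pw_def fun_eq_iff)

lemma leading_1: "leading 0 (\<lambda>x. 1) 1"
  by (simp add: leading_def)

lemma leading_pw: "leading d (\<lambda>x. c * pw d x) c"
  unfolding leading_def
  by (rule tendsto_eventually, rule eventually_mono[OF eventually_pw_nonzero[of d]]) simp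

lemma leading_power_nat: "leading d f c \<Longrightarrow> leading (int n * d) (\<lambda>x. f x ^ n) (c ^ n)"
  using leading_mult[of d f c "int n * d" "\<lambda>x. f x ^ n" "c ^ n" for n]
  by (induction n) (auto simp: leading_1 algebra_simps)

lemma leading_power_int:
  assumes "leading d f c" "c \<noteq> 0"
  shows "leading (n * d) (\<lambda>x. f x powi n) (c powi n)"
proof (cases "n \<ge> 0")
  case True
  then show ?thesis using leading_power_nat[OF assms(1), of "nat n"] by (simp add: power_int_def)
next
  case False
  then show ?thesis
    using leading_inverse[OF leading_power_nat[OF assms(1), of "nat (- n)"]] assms
    by (simp add: power_int_def power_inverse)
qed

lemma bigo_lower_leading:
  assumes "f \<in> O[at_top](pw e)" "e < d"
  shows "leading d f 0"
proof -
  have "((\<lambda>x::real. inverse (x ^ nat (d - e))) \<longlongrightarrow> 0) at_top"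
    using assms by (intro tendsto_inverse_0_at_top filterlim_pow_at_top filterlim_ident) auto
  then have "((\<lambda>x::real. complex_of_real (inverse (x ^ nat (d - e)))) \<longlongrightarrow> complex_of_real 0) at_top"
    by (rule tendsto_of_real)
  moreover have "\<forall>\<^sub>F x in at_top. complex_of_real (inverse (x ^ nat (d - e))) = pw e x / pw d x"
    using eventually_gt_at_top[of 0]
  proof eventually_elim
    case (elim x)
    have "pw e x / pw d x = pw (- (d - e)) x"
      using elim pw_add[of x e "- d"] by (simp add: pw_minus divide_inverse)
    then show ?case using assms by (simp add: pw_minus) (simp add: pw_def power_int_def power_inverse)
  qed
  ultimately have "((\<lambda>x. pw e x / pw d x) \<longlongrightarrow> 0) at_top"
    using Lim_transform_eventually by fastforce
  then have "pw e \<in> o[at_top](pw d)"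
    using eventually_pw_nonzero by (rule smalloI_tendsto)
  with assms(1) have "f \<in> o[at_top](pw d)"
    by (rule landau_o.big_small_trans)
  then show ?thesis unfolding leading_def by (rule smalloD_tendsto)
qed

lemma symbol_leading: "symbol (d - 1) (\<lambda>x. f x - c * pw d x) \<Longrightarrow> leading d f c"
proof -
  assume "symbol (d - 1) (\<lambda>x. f x - c * pw d x)"
  from bigo_lower_leading[OF symbol_bigo[OF this], of d] leading_pw[of d c]
  have "leading d (\<lambda>x. (f x - c * pw d x) + c * pw d x) (0 + c)"
    unfolding leading_def add_divide_distrib by (intro tendsto_add) auto
  then show ?thesis by simp
qed

text \<open>A nonzero leading coefficient makes \<open>f\<close> eventually nonzero and bounds
  \<open>1 / f\<close> by a multiple of x^(-d), the two inputs of
  \<open>symbol_upto_inverse\<close>.\<close>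

lemma symbol_inverse:
  assumes "symbol d f" "leading d f c" "c \<noteq> 0"
  shows "symbol (- d) (\<lambda>x. inverse (f x))"
proof -
  obtain b where b: "\<And>n. symbol_upto n b d f" using assms(1) by (auto simp: symbol_def)
  obtain a where a: "\<And>x. x > a \<Longrightarrow> f x \<noteq> 0" 
    using leading_nonzero[OF assms(2,3)] by (auto simp: eventually_at_top_dense)
  have o: "(\<lambda>x. inverse (f x)) \<in> O[at_top](pw (- d))"
    using leading_bigtheta[OF leading_inverse[OF assms(2,3)]] assms(3) by auto
  have "symbol_upto n (max a b) (- d) (\<lambda>x. inverse (f x))" for n
    using a o symbol_upto_mono_threshold[OF b, of "max a b"] by (intro symbol_upto_inverse) auto
  then show ?thesis by (auto simp: symbol_def)
qed

lemma symbol_compose: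
  fixes g :: "real \<Rightarrow> real"
  assumes f: "symbol d f" and g: "symbol s (\<lambda>x. of_real (g x))"
    and l: "leading s (\<lambda>x. of_real (g x)) c" "c \<noteq> 0" and lim: "filterlim g at_top at_top"
  shows "symbol (s * d) (\<lambda>x. f (g x))"
proof -
  obtain b where b: "\<And>n. symbol_upto n b d f" using f by (auto simp: symbol_def)
  obtain a where a: "\<And>n. symbol_upto n a (s - 1) (vd (\<lambda>x. complex_of_real (g x)))"
    using symbol_vd[OF g] by (auto simp: symbol_def)
  obtain a' where a': "\<And>x. x > a' \<Longrightarrow> g x > b"
    using lim by (auto simp: filterlim_at_top_dense eventually_at_top_dense)
  obtain a'' where a'': "\<And>x. x > a'' \<Longrightarrow> g differentiable at x"
      "\<And>x. x > a'' \<Longrightarrow> vd (\<lambda>x. complex_of_real (g x)) x = of_real (vd g x)"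
    using smooth_at_top_of_real[of g] g by (auto simp: symbol_iff) (metis hderiv_0 hderiv_1)
  define B where "B = max a (max a' a'')"
  have 1: "symbol_upto n B (s - 1) (\<lambda>x. complex_of_real (vd g x))" for n
    using symbol_upto_mono_threshold[OF a, of B] by (rule symbol_upto_cong) (auto simp: B_def a'')
  \<comment> \<open>For negative \<open>d\<close> this needs \<open>g\<close> bounded below; the
    nonzero leading coefficient makes \<open>g\<close> comparable to x^s.\<close>
  have 2: "(\<lambda>x. pw d (g x)) \<in> O[at_top](pw (s * d))" for d
  proof -
    have "(\<lambda>x. of_real (g x) powi d) \<in> O[at_top](pw (d * s))"
      using leading_bigtheta[OF leading_power_int[OF l]] l by auto
    then show ?thesis by (simp add: pw_def[abs_def] mult.commute)
  qed
  have "symbol_upto n B (s * d) (\<lambda>x. f (g x))" for n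
    by (rule symbol_upto_compose[OF _ lim 2 b _ 1]) (auto simp: B_def a' a'')
  then show ?thesis by (auto simp: symbol_def)
qed

section \<open>Asymptotic expansions in integer powers\<close>

text \<open>Each step removes one term and lowers the order, so \<open>N\<close> steps leave a
  symbol of order \<open>d - N\<close>. Coefficients are only asserted to exist for each
  \<open>N\<close>; that they agree for different \<open>N\<close> follows from uniqueness of
  limits.\<close>

primrec expands_upto :: "nat \<Rightarrow> int \<Rightarrow> (real \<Rightarrow> complex) \<Rightarrow> bool" where
  "expands_upto 0 d f \<longleftrightarrow> symbol d f"
| "expands_upto (Suc N) d f \<longleftrightarrow> (\<exists>c. expands_upto N (d - 1) (\<lambda>x. f x - c * pw d x))"

definition expandable :: "int \<Rightarrow> (real \<Rightarrow> complex) \<Rightarrow> bool" where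
  "expandable d f \<longleftrightarrow> (\<forall>N. expands_upto N d f)"

lemma expands_upto_cong:
  "expands_upto N d f \<Longrightarrow> \<forall>\<^sub>F x in at_top. f x = g x \<Longrightarrow> expands_upto N d g"
proof (induction N arbitrary: d f g)
  case (Suc N)
  from Suc.prems(1) obtain c where "expands_upto N (d - 1) (\<lambda>x. f x - c * pw d x)" by auto
  then have "expands_upto N (d - 1) (\<lambda>x. g x - c * pw d x)"
    by (rule Suc.IH) (use Suc.prems(2) in eventually_elim, simp)
  then show ?case by auto
qed (auto intro: symbol_cong)

lemma symbol_sub_pw: "symbol (d - 1) (\<lambda>x. f x - c * pw d x) \<Longrightarrow> symbol d f"
  using symbol_add[OF symbol_mono[of "d - 1" "\<lambda>x. f x - c * pw d x" d] symbol_pw[of d c]] by simp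

lemma expands_upto_Suc: "expands_upto (Suc N) d f \<Longrightarrow> expands_upto N d f"
proof (induction N arbitrary: d f)
  case 0
  then show ?case by (auto intro: symbol_sub_pw)
next
  case (Suc N)
  then obtain c where "expands_upto (Suc N) (d - 1) (\<lambda>x. f x - c * pw d x)"
    unfolding expands_upto.simps(2)[of "Suc N"] by blast
  then have "expands_upto N (d - 1) (\<lambda>x. f x - c * pw d x)" by (rule Suc.IH)
  then show ?case by auto
qed

lemma expands_upto_symbol: "expands_upto N d f \<Longrightarrow> symbol d f"
  by (induction N) (auto dest: expands_upto_Suc simp del: expands_upto.simps(2))

text \<open>A zero coefficient in front gains one term.\<close>

lemma expands_upto_lift: "expands_upto N (d - 1) f \<Longrightarrow> expands_upto (Suc N) d f"
  by (auto intro!: exI[of _ 0])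

lemma expands_upto_mono: "expands_upto N d f \<Longrightarrow> d \<le> e \<Longrightarrow> expands_upto N e f"
proof -
  assume f: "expands_upto N d f" and "d \<le> e"
  show ?thesis
    using \<open>d \<le> e\<close>
  proof (induction e rule: int_ge_induct)
    case (step e)
    then show ?case using expands_upto_Suc[OF expands_upto_lift[of N "e + 1" f]] by simp
  qed (rule f)
qed

lemma expands_upto_zero: "expands_upto N d (\<lambda>x. 0)"
  by (induction N arbitrary: d) (auto simp: symbol_zero intro: exI[of _ 0])

lemma expands_upto_pw: "expands_upto N d (\<lambda>x. c * pw d x)"
proof (cases N)
  case (Suc M)
  then show ?thesis by (auto intro!: exI[of _ c] expands_upto_zero)
qed (simp add: symbol_pw)

lemma expands_upto_add:
  "expands_upto N d f \<Longrightarrow> expands_upto N d g \<Longrightarrow> expands_upto N d (\<lambda>x. f x + g x)"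
proof (induction N arbitrary: d f g)
  case (Suc N)
  then obtain a b where "expands_upto N (d - 1) (\<lambda>x. f x - a * pw d x)"
     "expands_upto N (d - 1) (\<lambda>x. g x - b * pw d x)" by auto
  from Suc.IH[OF this] have "expands_upto N (d - 1) (\<lambda>x. (f x + g x) - (a + b) * pw d x)"
    by (simp add: algebra_simps)
  then show ?case by auto
qed (auto intro: symbol_add)

lemma expands_upto_mult:
  "expands_upto N d f \<Longrightarrow> expands_upto N e g \<Longrightarrow> expands_upto N (d + e) (\<lambda>x. f x * g x)"
proof (induction N arbitrary: d e f g)
  case (Suc N)
  then obtain a b where ab: "expands_upto N (d - 1) (\<lambda>x. f x - a * pw d x)"
     "expands_upto N (e - 1) (\<lambda>x. g x - b * pw e x)" by auto
  \<comment> \<open>With leading terms \<open>a x^d\<close> and \<open>b x^e\<close>, the remainder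
    \<open>f g - a b x^(d+e)\<close> is \<open>(f - a x^d) g + a x^d (g - b x^e)\<close>. In each
    product one factor has already lost an order, so \<open>N\<close> terms suffice.\<close>
  have "expands_upto N ((d - 1) + e) (\<lambda>x. (f x - a * pw d x) * g x)"
    using ab Suc.prems expands_upto_Suc by (intro Suc.IH) blast+
  moreover have "expands_upto N (d + (e - 1)) (\<lambda>x. (a * pw d x) * (g x - b * pw e x))"
    using ab expands_upto_pw by (intro Suc.IH) blast+
  ultimately have "expands_upto N (d + e - 1) (\<lambda>x. (f x - a * pw d x) * g x + (a * pw d x) * (g x - b * pw e x))"
    by (intro expands_upto_add) (simp_all add: algebra_simps)
  then have "expands_upto N (d + e - 1) (\<lambda>x. f x * g x - (a * b) * pw (d + e) x)"
    by (rule expands_upto_cong)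
       (rule eventually_mono[OF eventually_gt_at_top[of 0]], simp add: pw_add algebra_simps)
  then show ?case by auto
qed (auto intro: symbol_mult)

text \<open>Removing a term commutes with differentiation, so no term is lost. For
  \<open>d = 0\<close> the new coefficient is zero, which the definition permits.\<close>

lemma expands_upto_vd: "expands_upto N d f \<Longrightarrow> expands_upto N (d - 1) (vd f)"
proof (induction N arbitrary: d f)
  case (Suc N)
  then obtain c where c: "expands_upto N (d - 1) (\<lambda>x. f x - c * pw d x)" by auto
  have "\<forall>\<^sub>F x in at_top. f differentiable at x"
    by (rule symbol_differentiable[OF expands_upto_symbol[OF Suc.prems]])
  with eventually_gt_at_top[of 0]
  have "\<forall>\<^sub>F x in at_top. vd (\<lambda>x. f x - c * pw d x) x = vd f x - (c * of_int d) * pw (d - 1) x"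
  proof eventually_elim
    case (elim x)
    have "((\<lambda>x. f x - c * pw d x) has_vector_derivative vd f x - c * (of_int d * pw (d - 1) x)) (at x)"
      using elim by (intro has_vector_derivative_diff has_vector_derivative_mult_right
          pw_has_vector_derivative vector_derivative_has)
    then show ?case by (simp add: vector_derivative_at mult_ac)
  qed
  with Suc.IH[OF c] have "expands_upto N (d - 1 - 1) (\<lambda>x. vd f x - (c * of_int d) * pw (d - 1) x)"
    by (rule expands_upto_cong)
  then show ?case by auto
qed (auto intro: symbol_vd)

lemma expandable_cong:
  "expandable d f \<Longrightarrow> \<forall>\<^sub>F x in at_top. f x = g x \<Longrightarrow> expandable d g"
  by (auto simp: expandable_def intro: expands_upto_cong)

lemma expandable_mono: "expandable d f \<Longrightarrow> d \<le> e \<Longrightarrow> expandable e f"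
  by (auto simp: expandable_def intro: expands_upto_mono)

lemma expandable_pw: "expandable d (\<lambda>x. c * pw d x)"
  by (auto simp: expandable_def intro: expands_upto_pw)

lemma expandable_add: "expandable d f \<Longrightarrow> expandable d g \<Longrightarrow> expandable d (\<lambda>x. f x + g x)"
  by (auto simp: expandable_def intro: expands_upto_add)

lemma expandable_mult:
  "expandable d f \<Longrightarrow> expandable e g \<Longrightarrow> expandable (d + e) (\<lambda>x. f x * g x)"
  by (auto simp: expandable_def intro: expands_upto_mult)

lemma expandable_const: "expandable 0 (\<lambda>x. c)"
  using expandable_pw[of 0 c] by simp

lemma expandable_scale: "expandable d f \<Longrightarrow> expandable d (\<lambda>x. c * f x)"
  using expandable_mult[OF expandable_const] by fastforce

lemma expandable_vd: "expandable d f \<Longrightarrow> expandable (d - 1) (vd f)"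
  by (auto simp: expandable_def intro: expands_upto_vd)

lemma expandable_symbol: "expandable d f \<Longrightarrow> symbol d f"
  by (auto simp: expandable_def intro: expands_upto_symbol)

text \<open>Each \<open>N\<close> comes with its own first coefficient, but all of them are the
  limit of \<open>f / x^d\<close>, so a single \<open>c\<close> serves every
  \<open>N\<close>.\<close>

lemma expandable_step:
  assumes "expandable d f"
  shows "\<exists>c. leading d f c \<and> expandable (d - 1) (\<lambda>x. f x - c * pw d x)"
proof -
  have "\<forall>N. \<exists>c. expands_upto N (d - 1) (\<lambda>x. f x - c * pw d x)"
    using assms unfolding expandable_def by (metis expands_upto.simps(2))
  then obtain c where c: "\<And>N. expands_upto N (d - 1) (\<lambda>x. f x - c N * pw d x)"
    by metis
  then have l: "leading d f (c N)" for N
    by (intro symbol_leading expands_upto_symbol)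
  then have "c N = c 0" for N
    by (rule leading_unique) (rule l)
  with c l show ?thesis unfolding expandable_def by metis
qed

lemma expandable_leading_step:
  "expandable d f \<Longrightarrow> leading d f c \<Longrightarrow> expandable (d - 1) (\<lambda>x. f x - c * pw d x)"
  using expandable_step leading_unique by blast

lemma expandable_inverse:
  assumes f: "expandable d f" and c: "leading d f c" "c \<noteq> 0"
  shows "expandable (- d) (\<lambda>x. inverse (f x))"
proof -
  have "expands_upto N (- d) (\<lambda>x. inverse (f x))" for N
  proof (induction N)
    case 0
    then show ?case using symbol_inverse[OF expandable_symbol[OF f] c] by simp
  next
    case (Suc N)
    \<comment> \<open>The remainder \<open>1/f - 1/(c x^d)\<close> equals
      \<open>(f - c x^d) * (- 1/(c x^d)) * (1/f)\<close>. The first factor gains an order and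
      \<open>1/f\<close> is known to \<open>N\<close> terms by induction, which yields
      \<open>N + 1\<close> terms.\<close>
    have "expands_upto N ((d - 1) + - d) (\<lambda>x. (f x - c * pw d x) * (- inverse c * pw (- d) x))"
      using expandable_leading_step[OF f c(1)] expands_upto_pw[of N "- d" "- inverse c"]
      by (intro expands_upto_mult) (auto simp: expandable_def)
    moreover have "(d - 1) + - d + - d = - d - 1" by simp
    ultimately have "expands_upto N (- d - 1) (\<lambda>x. (f x - c * pw d x) * (- inverse c * pw (- d) x) * inverse (f x))"
      using expands_upto_mult[OF _ Suc] by metis
    then have "expands_upto N (- d - 1) (\<lambda>x. inverse (f x) - inverse c * pw (- d) x)"
    proof (rule expands_upto_cong)
      show "\<forall>\<^sub>F x in at_top. (f x - c * pw d x) * (- inverse c * pw (- d) x) * inverse (f x) =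
         inverse (f x) - inverse c * pw (- d) x"
        using leading_nonzero[OF c] eventually_pw_nonzero[of d]
        by eventually_elim (use c in \<open>simp add: pw_minus field_simps\<close>)
    qed
    then show ?case by auto
  qed
  then show ?thesis by (simp add: expandable_def)
qed

lemma expandable_power_nat: "expandable d f \<Longrightarrow> expandable (int n * d) (\<lambda>x. f x ^ n)"
proof (induction n)
  case (Suc n)
  then show ?case using expandable_mult[of d f "int n * d" "\<lambda>x. f x ^ n"] by (simp add: algebra_simps)
qed (simp add: expandable_const)

lemma expandable_power_int:
  assumes "expandable d f" "leading d f c" "c \<noteq> 0"
  shows "expandable (n * d) (\<lambda>x. f x powi n)"
proof (cases "n \<ge> 0")
  case True
  then show ?thesis using expandable_power_nat[OF assms(1), of "nat n"] by (simp add: power_int_def)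
next
  case False
  then show ?thesis
    using expandable_inverse[OF expandable_power_nat[OF assms(1)] leading_power_nat[OF assms(2)], of "nat (- n)"] assms
    by (simp add: power_int_def power_inverse)
qed

lemma expandable_compose:
  fixes g :: "real \<Rightarrow> real"
  assumes "expandable d f" and g: "expandable s (\<lambda>x. of_real (g x))"
    and l: "leading s (\<lambda>x. of_real (g x)) c" "c \<noteq> 0" and lim: "filterlim g at_top at_top"
    and s: "s > 0"
  shows "expandable (s * d) (\<lambda>x. f (g x))"
proof -
  have "expandable d f \<Longrightarrow> expands_upto N (s * d) (\<lambda>x. f (g x))" for N d f
  proof (induction N arbitrary: d f)
    case 0
    then show ?case
      using symbol_compose[OF expandable_symbol expandable_symbol[OF g] l lim] by simp
  next
    case (Suc N)
    from expandable_step[OF Suc.prems] obtain a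
      where a: "expandable (d - 1) (\<lambda>x. f x - a * pw d x)" by blast
    \<comment> \<open>The composed remainder has order \<open>s (d - 1)\<close>, at most
      \<open>s d - 1\<close> because \<open>s \<ge> 1\<close>: exactly the order needed to pass from
      \<open>N\<close> to \<open>N + 1\<close> terms. The removed term becomes a power of
      \<open>g\<close>.\<close>
    have "expands_upto N (s * d - 1) (\<lambda>x. f (g x) - a * pw d (g x))"
      using Suc.IH[OF a] by (rule expands_upto_mono) (use s in \<open>simp add: algebra_simps\<close>)
    moreover have "expandable (s * d) (\<lambda>x. a * pw d (g x))"
      using expandable_scale[OF expandable_power_int[OF g l, of d]] by (simp add: pw_def mult.commute)
    ultimately have "expands_upto (Suc N) (s * d) (\<lambda>x. (f (g x) - a * pw d (g x)) + a * pw d (g x))"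
      unfolding expandable_def by (intro expands_upto_add) (erule expands_upto_lift, blast)
    then show ?case by simp
  qed
  with assms show ?thesis by (simp add: expandable_def)
qed

lemma leading_compose:
  fixes g :: "real \<Rightarrow> real"
  assumes "leading d f a" "leading s (\<lambda>x. of_real (g x)) c" "c \<noteq> 0" "filterlim g at_top at_top"
  shows "leading (s * d) (\<lambda>x. f (g x)) (a * c powi d)"
proof -
  have "((\<lambda>x. f (g x) / pw d (g x)) \<longlongrightarrow> a) at_top"
    using filterlim_compose[OF assms(1)[unfolded leading_def] assms(4)] .
  moreover have "((\<lambda>x. pw d (g x) / pw (d * s) x) \<longlongrightarrow> c powi d) at_top"
    using leading_power_int[OF assms(2,3), of d] by (simp add: leading_def pw_def)
  ultimately have lim: "((\<lambda>x. (f (g x) / pw d (g x)) * (pw d (g x) / pw (d * s) x)) \<longlongrightarrow> a * c powi d) at_top"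
    by (rule tendsto_mult)
  have "\<forall>\<^sub>F x in at_top. pw d (g x) \<noteq> 0"
    using assms(4) eventually_pw_nonzero by (auto simp: filterlim_iff)
  then have "\<forall>\<^sub>F x in at_top. (f (g x) / pw d (g x)) * (pw d (g x) / pw (d * s) x) = f (g x) / pw (s * d) x"
    by eventually_elim (simp add: mult.commute)
  with lim show ?thesis unfolding leading_def by (rule Lim_transform_eventually)
qed

section \<open>Expansions and the classes A\<close>

lemma hderiv_diff:
  assumes "\<And>k x. x > b \<Longrightarrow> hderiv k f differentiable at x"
    and "\<And>k x. x > b \<Longrightarrow> hderiv k g differentiable at x" and "x > (b::real)"
  shows "hderiv k (\<lambda>x. f x - g x) x = hderiv k f x - hderiv k g x \<and>
    hderiv k (\<lambda>x. f x - g x) differentiable at x"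
  using assms(3)
proof (induction k arbitrary: x)
  case 0
  then show ?case using assms(1,2)[of x 0] by simp
next
  case (Suc k)
  have eq: "hderiv (Suc k) (\<lambda>x. f x - g x) y = hderiv (Suc k) f y - hderiv (Suc k) g y" if "y > b" for y
  proof -
    have "vd (hderiv k (\<lambda>x. f x - g x)) y = vd (\<lambda>y. hderiv k f y - hderiv k g y) y"
      using Suc.IH that by (intro vd_transform[of b]) auto
    also have "\<dots> = vd (hderiv k f) y - vd (hderiv k g) y"
      using assms that by (intro vector_derivative_at has_vector_derivative_diff vector_derivative_has) auto
    finally show ?thesis by (simp add: hderiv_Suc)
  qed
  have "(\<lambda>y. hderiv (Suc k) f y - hderiv (Suc k) g y) differentiable at x"
    using assms Suc.prems by (intro differentiable_diff) auto
  then have "hderiv (Suc k) (\<lambda>x. f x - g x) differentiable at x"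
    by (rule differentiable_transform[of _ _ b]) (use eq Suc.prems in auto)
  then show ?case using eq[OF Suc.prems] by simp
qed

lemma pw_sum_has_vector_derivative:
  fixes x :: real
  assumes "x > 0"
  shows "((\<lambda>x. \<Sum>i<N. a i * pw (d i) x) has_vector_derivative
    (\<Sum>i<N. a i * (of_int (d i) * pw (d i - 1) x))) (at x)"
  using assms
  by (intro has_vector_derivative_sum has_vector_derivative_mult_right pw_has_vector_derivative)

lemma hderiv_pw_sum:
  fixes x :: real
  assumes "x > 0"
  shows "hderiv k (\<lambda>x. \<Sum>i<N. a i * pw (d - int i) x) x =
     (\<Sum>i<N. a i * (\<Prod>j<k. of_int d - of_nat i - of_nat j) * pw (d - int k - int i) x)"
  using assms
proof (induction k arbitrary: x)
  case 0
  then show ?case by simp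
next
  case (Suc k)
  let ?h = "\<lambda>k x. \<Sum>i<N. a i * (\<Prod>j<k. of_int d - of_nat i - of_nat j) * pw (d - int k - int i) x"
  have "hderiv (Suc k) (\<lambda>x. \<Sum>i<N. a i * pw (d - int i) x) x = vd (?h k) x"
    unfolding hderiv_Suc by (rule vd_transform[of 0]) (use Suc in auto)
  also have "\<dots> = (\<Sum>i<N. a i * (\<Prod>j<k. of_int d - of_nat i - of_nat j) *
      (of_int (d - int k - int i) * pw (d - int k - int i - 1) x))"
    using Suc.prems
    by (intro vector_derivative_at pw_sum_has_vector_derivative)
  \<comment> \<open>The factor \<open>d - k - i\<close> brought down is the missing one with index
    \<open>j = k\<close>.\<close>
  also have "\<dots> = ?h (Suc k) x"
    by (rule sum.cong) (simp_all add: algebra_simps)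
  finally show ?case .
qed

lemma hderiv_pw_sum_differentiable:
  fixes x :: real
  assumes "x > 0"
  shows "hderiv k (\<lambda>x. \<Sum>i<N. a i * pw (d - int i) x) differentiable at x"
proof (rule differentiable_transform)
  show "(\<lambda>x. \<Sum>i<N. a i * (\<Prod>j<k. of_int d - of_nat i - of_nat j) * pw (d - int k - int i) x) differentiable at x"
    by (rule differentiableI_vector[OF pw_sum_has_vector_derivative[OF assms]])
qed (use assms hderiv_pw_sum in auto)

lemma smooth_at_top_minus_pw_sum:
  assumes "smooth_at_top f"
  shows "smooth_at_top (\<lambda>x. f x - (\<Sum>i<N. a i * pw (d - int i) x))"
    and "\<forall>\<^sub>F x in at_top. hderiv k (\<lambda>x. f x - (\<Sum>i<N. a i * pw (d - int i) x)) x =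
      hderiv k f x - (\<Sum>i<N. a i * (\<Prod>j<k. of_int d - of_nat i - of_nat j) * pw (d - int k - int i) x)"
proof -
  obtain b where b: "\<And>x k. x > b \<Longrightarrow> hderiv k f differentiable at x"
    using assms by (auto simp: smooth_at_top_iff)
  let ?T = "\<lambda>x. \<Sum>i<N. a i * pw (d - int i) x"
  have *: "hderiv k (\<lambda>x. f x - ?T x) x = hderiv k f x - hderiv k ?T x \<and>
      hderiv k (\<lambda>x. f x - ?T x) differentiable at x" if "x > max b 0" for x k
    using that by (intro hderiv_diff[of "max b 0"]) (auto intro: b hderiv_pw_sum_differentiable)
  then show "smooth_at_top (\<lambda>x. f x - ?T x)"
    unfolding smooth_at_top_iff by blast
  show "\<forall>\<^sub>F x in at_top. hderiv k (\<lambda>x. f x - ?T x) x =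
      hderiv k f x - (\<Sum>i<N. a i * (\<Prod>j<k. of_int d - of_nat i - of_nat j) * pw (d - int k - int i) x)"
    using eventually_gt_at_top[of "max b 0"]
    by eventually_elim (use * hderiv_pw_sum in auto)
qed

lemma powr_eq_pw: "x > 0 \<Longrightarrow> complex_of_real x powr (of_int d - of_nat k - of_nat i) = pw (d - int k - int i) x"
  using complex_powr_of_int[of "of_real x" "d - int k - int i"] by (simp add: pw_def)

text \<open>Differentiating the \<open>N\<close>-term remainder \<open>k\<close> times gives the
  remainder of the \<open>k\<close>-th derivative after termwise differentiation, so each Poincare
  condition is a bound of order \<open>d - N - k\<close>. Read with \<open>N\<close> fixed and
  \<open>k\<close> running, these bounds say that the remainder is a symbol.\<close>

lemma has_expansion_iff:
  "has_expansion f (of_int d) a \<longleftrightarrow>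
     (\<forall>N. symbol (d - int N) (\<lambda>x. f x - (\<Sum>i<N. a i * pw (d - int i) x)))"
  (is "?L \<longleftrightarrow> (\<forall>N. symbol _ (?R N))")
proof -
  have eq: "poincare (hderiv k f) (of_int d - of_nat k) (\<lambda>i. a i * (\<Prod>j<k. of_int d - of_nat i - of_nat j)) \<longleftrightarrow>
     (\<forall>N. hderiv k (?R N) \<in> O[at_top](pw (d - int N - int k)))" if "smooth_at_top f" for k
    unfolding poincare_def
  proof (intro all_cong1)
    fix N
    have *: "\<forall>\<^sub>F x in at_top. hderiv k (?R N) x = hderiv k f x - (\<Sum>i<N. a i * (\<Prod>j<k. of_int d - of_nat i - of_nat j) *
        complex_of_real x powr (of_int d - of_nat k - of_nat i))"
      using smooth_at_top_minus_pw_sum(2)[OF that, where k = k and N = N and a = a and d = d] eventually_gt_at_top[of 0]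
      by eventually_elim (simp add: powr_eq_pw)
    moreover have "O[at_top](pw (d - int N - int k)) = O[at_top](\<lambda>x. of_real x powr (of_int d - of_nat k - of_nat N))"
      by (intro landau_o.big.cong eventually_mono[OF eventually_gt_at_top[of 0]])
         (simp only: powr_eq_pw cancel_ab_semigroup_add_class.diff_right_commute[of d "int N"])
    ultimately show "(\<lambda>x. hderiv k f x - (\<Sum>i<N. a i * (\<Prod>j<k. of_int d - of_nat i - of_nat j) *
        complex_of_real x powr (of_int d - of_nat k - of_nat i)))
        \<in> O[at_top](\<lambda>x. of_real x powr (of_int d - of_nat k - of_nat N)) \<longleftrightarrow>
        hderiv k (?R N) \<in> O[at_top](pw (d - int N - int k))"
      using landau_o.big.in_cong[OF *] by simp
  qed
  \<comment> \<open>For \<open>N = 0\<close> the sum is empty and the remainder is \<open>f\<close>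
    itself.\<close>
  have smooth: "smooth_at_top f" if "\<forall>N. symbol (d - int N) (?R N)"
    using spec[OF that, of 0] by (simp add: symbol_iff)
  show ?thesis
  proof
    assume ?L
    then show "\<forall>N. symbol (d - int N) (?R N)"
      unfolding has_expansion_def symbol_iff using eq smooth_at_top_minus_pw_sum(1) by blast
  next
    assume R: "\<forall>N. symbol (d - int N) (?R N)"
    then show ?L
      unfolding has_expansion_def using eq smooth[OF R] by (auto simp: symbol_iff)
  qed
qed

lemma has_expansion_expandable:
  assumes "has_expansion f (of_int d) a"
  shows "expandable d f" "leading d f (a 0)"
proof -
  let ?R = "\<lambda>N x. f x - (\<Sum>i<N. a i * pw (d - int i) x)"
  have R: "symbol (d - int N) (?R N)" for N
    using assms by (simp add: has_expansion_iff)
  \<comment> \<open>Generalised to all remainders: removing the term with coefficient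
    \<open>a N\<close> turns remainder \<open>N\<close> into remainder \<open>N + 1\<close>.\<close>
  have "expands_upto M (d - int N) (?R N)" for M N
  proof (induction M arbitrary: N)
    case (Suc M)
    have "expands_upto M (d - int N - 1) (\<lambda>x. ?R N x - a N * pw (d - int N) x)"
      using Suc[of "Suc N"] by (simp add: algebra_simps)
    then show ?case by auto
  qed (simp add: R)
  from this[of _ 0] show "expandable d f" by (simp add: expandable_def)
  show "leading d f (a 0)"
    using R[of 1] by (intro symbol_leading) simp
qed

lemma expandable_has_expansion:
  assumes "expandable d f"
  shows "\<exists>a. has_expansion f (of_int d) a"
proof -
  \<comment> \<open>Dependent choice builds the successive remainders; the coefficients are read off
    afterwards from consecutive ones.\<close>
  have "\<exists>R. \<forall>n. (expandable (d - int n) (R n) \<and> (n = 0 \<longrightarrow> R n = f)) \<and>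
      (\<exists>c. R (Suc n) = (\<lambda>x. R n x - c * pw (d - int n) x))"
  proof (rule dependent_nat_choice)
    fix g n assume "expandable (d - int n) g \<and> (n = 0 \<longrightarrow> g = f)"
    then show "\<exists>h. (expandable (d - int (Suc n)) h \<and> (Suc n = 0 \<longrightarrow> h = f)) \<and>
       (\<exists>c. h = (\<lambda>x. g x - c * pw (d - int n) x))"
      using expandable_step[of "d - int n" g] by (auto simp: algebra_simps)
  qed (use assms in auto)
  then obtain R a where R: "\<And>n. expandable (d - int n) (R n)" "R 0 = f"
     and a: "\<And>n. R (Suc n) = (\<lambda>x. R n x - a n * pw (d - int n) x)"
    by metis
  have "R N = (\<lambda>x. f x - (\<Sum>i<N. a i * pw (d - int i) x))" for N
    by (induction N) (auto simp: R a algebra_simps)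
  then have "has_expansion f (of_int d) a"
    unfolding has_expansion_iff using expandable_symbol[OF R(1)] by metis
  then show ?thesis by blast
qed

lemma strict_A_iff: "f \<in> strict_A (of_int d) \<longleftrightarrow> expandable d f \<and> (\<exists>c. c \<noteq> 0 \<and> leading d f c)"
proof
  assume *: "expandable d f \<and> (\<exists>c. c \<noteq> 0 \<and> leading d f c)"
  then obtain c where c: "c \<noteq> 0" "leading d f c" by blast
  from * obtain a where a: "has_expansion f (of_int d) a" using expandable_has_expansion by blast
  with has_expansion_expandable(2)[OF a] c have "a 0 \<noteq> 0" using leading_unique by blast
  with a show "f \<in> strict_A (of_int d)" by (auto simp: strict_A_def)
qed (use has_expansion_expandable in \<open>auto simp: strict_A_def\<close>)

lemma strict_A_not_ev_zero: "f \<in> strict_A (of_int d) \<Longrightarrow> \<not> ev_zero f"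
proof
  assume "f \<in> strict_A (of_int d)" "ev_zero f"
  then obtain c where c: "c \<noteq> 0" "leading d f c" by (auto simp: strict_A_iff)
  have "\<forall>\<^sub>F x::real in at_top. False"
    using leading_nonzero[OF c(2,1)] \<open>ev_zero f\<close>[unfolded ev_zero_def]
    by eventually_elim simp
  then show False by (simp add: trivial_limit_at_top_linorder)
qed

lemma leading_order_unique:
  assumes "leading d f c" "c \<noteq> 0" "leading e f c'" "c' \<noteq> 0"
  shows "d = e"
proof -
  have *: False if l: "leading d f c" "c \<noteq> 0" "leading e f c'" "c' \<noteq> 0" "d < e" for d e c c'
  proof -
    have "leading e f 0"
      using leading_bigtheta[OF l(1,2)] that(5) by (intro bigo_lower_leading) auto
    then show False using leading_unique l(3,4) by blast
  qed
  show ?thesis using *[OF assms] *[OF assms(3,4,1,2)] by (cases d e rule: linorder_cases) auto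
qed

lemma strict_A_order_unique:
  "f \<in> strict_A (of_int d) \<Longrightarrow> f \<in> strict_A (of_int e) \<Longrightarrow> d = e"
  using leading_order_unique by (auto simp: strict_A_iff)

text \<open>The counterpart of the dichotomy in the families X, with an empty expansion in place of
  zero: the first nonzero coefficient, if there is one, becomes the leading one after an index
  shift.\<close>

lemma expandable_cases:
  assumes "expandable d f"
  shows "empty_expansion f \<or> (\<exists>j::nat. f \<in> strict_A (of_int (d - int j)))"
proof -
  obtain a where a: "has_expansion f (of_int d) a" using assms expandable_has_expansion by blast
  show ?thesis
  proof (cases "\<forall>i. a i = 0")
    case True
    then have "a = (\<lambda>_. 0)" by auto
    with a show ?thesis unfolding empty_expansion_def by metis
  next
    case False
    then obtain j where j: "a j \<noteq> 0" "\<And>i. i < j \<Longrightarrow> a i = 0"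
      using exists_least_iff[of "\<lambda>i. a i \<noteq> 0"] by blast
    have "has_expansion f (of_int (d - int j)) (\<lambda>i. a (j + i))"
      unfolding has_expansion_iff
    proof
      fix N
      have "(\<Sum>i<j + N. a i * pw (d - int i) x) = (\<Sum>i<N. a (j + i) * pw (d - int j - int i) x)" for x
      proof -
        have "(\<Sum>i<N. a (j + i) * pw (d - int j - int i) x) = (\<Sum>i\<in>{j..<j + N}. a i * pw (d - int i) x)"
          by (rule sum.reindex_bij_witness[of _ "\<lambda>i. i - j" "\<lambda>i. j + i"]) (auto simp: algebra_simps)
        also have "\<dots> = (\<Sum>i<j + N. a i * pw (d - int i) x)"
          by (rule sum.mono_neutral_left) (auto simp: j)
        finally show ?thesis by simp
      qed
      with a[unfolded has_expansion_iff, rule_format, of "j + N"]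
      show "symbol (d - int j - int N) (\<lambda>x. f x - (\<Sum>i<N. a (j + i) * pw (d - int j - int i) x))"
        by (simp add: algebra_simps)
    qed
    with j have "f \<in> strict_A (of_int (d - int j))" unfolding strict_A_def by force
    then show ?thesis by blast
  qed
qed

text \<open>The order inside \<open>empty_expansion\<close> is an unknown complex number. With all
  coefficients zero, taking more terms pushes the exponent below any bound in every derivative, so
  zero coefficients serve at every integer order.\<close>

lemma empty_expansion_expandable:
  assumes "empty_expansion f"
  shows "expandable d f"
proof -
  obtain \<gamma> where \<gamma>: "has_expansion f \<gamma> (\<lambda>_. 0)" using assms by (auto simp: empty_expansion_def)
  have "symbol d f" for d
    unfolding symbol_iff
  proof (intro conjI allI)
    show "smooth_at_top f" using \<gamma> by (simp add: has_expansion_def)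
    fix k
    obtain N :: nat where N: "Re \<gamma> - real_of_int d \<le> real N" using real_arch_simple by blast
    have "hderiv k f \<in> O[at_top](\<lambda>x. complex_of_real x powr (\<gamma> - of_nat k - of_nat N))"
      using \<gamma> by (simp add: has_expansion_def poincare_def)
    also have "(\<lambda>x. complex_of_real x powr (\<gamma> - of_nat k - of_nat N)) \<in> O[at_top](pw (d - int k))"
    proof (rule bigoI[of _ 1])
      show "\<forall>\<^sub>F x in at_top. norm (complex_of_real x powr (\<gamma> - of_nat k - of_nat N)) \<le> 1 * norm (pw (d - int k) x)"
        using eventually_ge_at_top[of 1]
      proof eventually_elim
        case (elim x)
        have "norm (complex_of_real x powr (\<gamma> - of_nat k - of_nat N)) = x powr (Re \<gamma> - real k - real N)"
          using elim norm_powr_real_powr[of "of_real x" "\<gamma> - of_nat k - of_nat N"] by simp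
        also have "\<dots> \<le> x powr (real_of_int (d - int k))"
          using elim N by (intro powr_mono) auto
        also have "\<dots> = norm (pw (d - int k) x)"
          using elim by (subst powr_real_of_int') (auto simp: pw_def norm_power_int)
        finally show ?case by simp
      qed
    qed
    finally show "hderiv k f \<in> O[at_top](pw (d - int k))" .
  qed
  then have "expands_upto N d f" for N d
    by (induction N arbitrary: d) (auto intro!: exI[of _ 0])
  then show ?thesis by (simp add: expandable_def)
qed

section \<open>Bell polynomials and Faa di Bruno's formula\<close>

text \<open>A common index bound \<open>N\<close> lets exponents for different \<open>n\<close> and \<open>k\<close> be compared; the range of
  \<open>bell_index\<close> depends on \<open>n - k\<close>.\<close>

definition bell_exponents :: "nat \<Rightarrow> nat \<Rightarrow> nat \<Rightarrow> (nat \<Rightarrow> nat) set" where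
  "bell_exponents N n k = {j. (\<forall>i. i \<notin> {1..N} \<longrightarrow> j i = 0) \<and>
     (\<Sum>i=1..N. j i) = k \<and> (\<Sum>i=1..N. i * j i) = n}"

text \<open>Divided powers. Summed over exponents of degree \<open>k\<close> and weight
  \<open>n\<close>, these monomials give the coefficient of t^n in the \<open>k\<close>-th power of
  \<open>w 1 t + ... + w N t^N\<close>, divided by \<open>k!\<close>. Factorials \<open>i!\<close>
  are absorbed into \<open>w i\<close>.\<close>

definition bell_monom :: "nat \<Rightarrow> (nat \<Rightarrow> nat) \<Rightarrow> (nat \<Rightarrow> complex) \<Rightarrow> complex" where
  "bell_monom N j w = (\<Prod>i=1..N. w i ^ j i / fact (j i))"

definition bell_sum :: "nat \<Rightarrow> nat \<Rightarrow> nat \<Rightarrow> (nat \<Rightarrow> complex) \<Rightarrow> complex" where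
  "bell_sum N n k w = (\<Sum>j\<in>bell_exponents N n k. bell_monom N j w)"

lemma finite_bell_exponents: "finite (bell_exponents N n k)"
proof (rule finite_subset)
  show "bell_exponents N n k \<subseteq> {j. \<forall>i. (i \<in> {1..N} \<longrightarrow> j i \<in> {..k}) \<and> (i \<notin> {1..N} \<longrightarrow> j i = 0)}"
    using member_le_sum[of _ "{1..N}"] by (auto simp: bell_exponents_def)
  show "finite {j::nat\<Rightarrow>nat. \<forall>i. (i \<in> {1..N} \<longrightarrow> j i \<in> {..k}) \<and> (i \<notin> {1..N} \<longrightarrow> j i = 0)}"
    by (rule finite_set_of_finite_funs) auto
qed

lemma bell_exponents_le: "j \<in> bell_exponents N n k \<Longrightarrow> k \<le> n"
  by (auto simp: bell_exponents_def intro!: sum_mono)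

lemma bell_exponents_bound:
  assumes "j \<in> bell_exponents N n k" "j i > 0"
  shows "i \<ge> 1" "i \<le> N" "i \<le> n" "k \<ge> 1" "i \<le> n - k + 1"
proof -
  show i: "i \<ge> 1" "i \<le> N"
    using assms by (force simp: bell_exponents_def)+
  have "j i \<le> k"
    using assms i member_le_sum[of i "{1..N}" j] by (auto simp: bell_exponents_def)
  then show "k \<ge> 1" using assms by simp
  have "i * j i \<le> n"
    using assms i member_le_sum[of i "{1..N}" "\<lambda>i. i * j i"] by (auto simp: bell_exponents_def)
  moreover have "i * 1 \<le> i * j i" using assms(2) by (intro mult_left_mono) auto
  ultimately show "i \<le> n" by linarith
  \<comment> \<open>Subtracting the degree from the weight leaves the sum of
    \<open>(l - 1) * j l\<close> equal to \<open>n - k\<close>, so an index that occurs satisfies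
    \<open>i - 1 \<le> n - k\<close>.\<close>
  have "n = (\<Sum>l=1..N. (l - 1) * j l + j l)"
    using assms unfolding bell_exponents_def
    by (auto intro!: sum.cong simp: diff_mult_distrib)
  also have "\<dots> = (\<Sum>l=1..N. (l - 1) * j l) + k"
    using assms by (simp add: bell_exponents_def sum.distrib)
  finally have "(\<Sum>l=1..N. (l - 1) * j l) = n - k" by simp
  moreover have "(i - 1) * j i \<le> (\<Sum>l=1..N. (l - 1) * j l)"
    using i by (intro member_le_sum) auto
  moreover have "(i - 1) * 1 \<le> (i - 1) * j i" using assms(2) by (intro mult_left_mono) auto
  ultimately show "i \<le> n - k + 1" by linarith
qed

lemma bell_eq_bell_sum:
  assumes "N \<ge> n - k + 1"
  shows "bell n k y = fact n * bell_sum N n k (\<lambda>i. y i / fact i)"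
proof -
  let ?M = "n - k + 1"
  have eq0: "(\<Sum>i=1..?M. j i) = (\<Sum>i=1..N. j i)"
    if "\<And>i. i \<notin> {1..?M} \<Longrightarrow> j i = (0::nat)" for j
    using that assms by (intro sum.mono_neutral_left) auto
  have "bell n k y = (\<Sum>j\<in>bell_exponents N n k. fact n * bell_monom N j (\<lambda>i. y i / fact i))"
    unfolding bell_def
  \<comment> \<open>The encodings differ outside the range: functions in \<open>bell_index\<close>
    are \<open>undefined\<close> there, those in \<open>bell_exponents\<close> are zero. The bound
    \<open>i \<le> n - k + 1\<close> makes restriction and extension by zero mutually
    inverse.\<close>
  proof (rule sum.reindex_bij_witness[of _ "\<lambda>j. restrict j {1..?M}" "\<lambda>j i. if i \<in> {1..?M} then j i else 0"])
    fix j assume j: "j \<in> bell_index n k"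
    let ?j = "\<lambda>i. if i \<in> {1..?M} then j i else 0"
    show "restrict ?j {1..?M} = j"
      using j by (auto simp: bell_index_def fun_eq_iff PiE_def extensional_def)
    have "(\<Sum>i=1..?M. ?j i) = k" "(\<Sum>i=1..?M. i * ?j i) = n"
      using j unfolding bell_index_def by auto
    moreover have "(\<Sum>i=1..?M. ?j i) = (\<Sum>i=1..N. ?j i)" "(\<Sum>i=1..?M. i * ?j i) = (\<Sum>i=1..N. i * ?j i)"
    proof -
      have z: "?j i = 0" if "i \<notin> {1..?M}" for i by (rule if_not_P[OF that])
      show "(\<Sum>i=1..?M. ?j i) = (\<Sum>i=1..N. ?j i)" by (rule eq0[OF z])
      show "(\<Sum>i=1..?M. i * ?j i) = (\<Sum>i=1..N. i * ?j i)" by (rule eq0) auto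
    qed
    ultimately have "(\<Sum>i=1..N. ?j i) = k" "(\<Sum>i=1..N. i * ?j i) = n"
      by (simp_all only:)
    then show "?j \<in> bell_exponents N n k"
      using assms by (auto simp: bell_exponents_def)
    have "bell_monom N ?j (\<lambda>i. y i / fact i) = (\<Prod>i=1..?M. (y i / fact i) ^ j i / fact (j i))"
      unfolding bell_monom_def using assms by (intro prod.mono_neutral_cong_right) auto
    then show "fact n * bell_monom N ?j (\<lambda>i. y i / fact i) =
        fact n / (\<Prod>i=1..?M. fact (j i)) * (\<Prod>i=1..?M. (y i / fact i) ^ j i)"
      by (simp add: prod_dividef)
  next
    fix j assume j: "j \<in> bell_exponents N n k"
    have z: "j i = 0" if "i \<notin> {1..?M}" for i
      using bell_exponents_bound[OF j, of i] that by fastforce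
    then show "(\<lambda>i. if i \<in> {1..?M} then restrict j {1..?M} i else 0) = j"
      by (auto simp: fun_eq_iff)
    have "(\<Sum>i=1..?M. j i) = k" "(\<Sum>i=1..?M. i * j i) = n"
      using j eq0[of j] eq0[of "\<lambda>i. i * j i"] z by (auto simp: bell_exponents_def)
    then show "restrict j {1..?M} \<in> bell_index n k"
      by (auto simp: bell_index_def)
  qed
  then show ?thesis by (simp add: bell_sum_def sum_distrib_left)
qed

section \<open>Shifting exponents and differentiating Bell sums\<close>

definition incr :: "nat \<Rightarrow> (nat \<Rightarrow> nat) \<Rightarrow> nat \<Rightarrow> nat" where
  "incr i j = j(i := Suc (j i))"

definition decr :: "nat \<Rightarrow> (nat \<Rightarrow> nat) \<Rightarrow> nat \<Rightarrow> nat" where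
  "decr i j = j(i := j i - 1)"

lemma decr_incr [simp]: "decr i (incr i j) = j"
  by (simp add: incr_def decr_def)

lemma incr_decr: "j i > 0 \<Longrightarrow> incr i (decr i j) = j"
  by (auto simp: incr_def decr_def)

lemma incr_pos [simp]: "incr i j i > 0"
  by (simp add: incr_def)

lemma incr_exponents:
  assumes "i \<in> {1..N}"
  shows "incr i j \<in> bell_exponents N (n + i) (Suc k) \<longleftrightarrow> j \<in> bell_exponents N n k"
proof -
  \<comment> \<open>A general weight \<open>c\<close> covers both constraints: the constant 1 gives
    the degree, the identity the weight.\<close>
  have *: "(\<Sum>l=1..N. c l * incr i j l) = (\<Sum>l=1..N. c l * j l) + c i" for c :: "nat \<Rightarrow> nat"
  proof -
    have "(\<Sum>l=1..N. c l * incr i j l) = (\<Sum>l=1..N. c l * j l + (if l = i then c i else 0))"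
      by (intro sum.cong) (auto simp: incr_def)
    then show ?thesis using assms by (simp add: sum.distrib)
  qed
  show ?thesis
    using *[of "\<lambda>_. 1"] *[of "\<lambda>l. l"] assms unfolding bell_exponents_def
    by (auto simp: incr_def) 
qed

lemma decr_exponents:
  assumes "j \<in> bell_exponents N n k" "j i > 0"
  shows "decr i j \<in> bell_exponents N (n - i) (k - 1)"
  using incr_exponents[of i N "decr i j" "n - i" "k - 1"] bell_exponents_bound[OF assms] assms
  by (simp add: incr_decr)

lemma bell_monom_remove:
  assumes "i \<in> {1..N}"
  shows "bell_monom N j w = w i ^ j i / fact (j i) * (\<Prod>l\<in>{1..N} - {i}. w l ^ j l / fact (j l))"
  unfolding bell_monom_def using assms by (intro prod.remove) auto

lemma bell_monom_incr:
  assumes "i \<in> {1..N}"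
  shows "w i * bell_monom N j w = of_nat (Suc (j i)) * bell_monom N (incr i j) w"
proof -
  have "(\<Prod>l\<in>{1..N} - {i}. w l ^ incr i j l / fact (incr i j l)) = (\<Prod>l\<in>{1..N} - {i}. w l ^ j l / fact (j l))"
    by (intro prod.cong) (auto simp: incr_def)
  then show ?thesis
    unfolding bell_monom_remove[OF assms] by (simp add: incr_def divide_simps del: of_nat_Suc)
qed

lemma has_vector_derivative_prod:
  fixes f :: "'i \<Rightarrow> real \<Rightarrow> complex"
  assumes "\<And>i. i \<in> I \<Longrightarrow> (f i has_vector_derivative f' i) (at x)"
  shows "((\<lambda>x. \<Prod>i\<in>I. f i x) has_vector_derivative (\<Sum>i\<in>I. f' i * (\<Prod>l\<in>I - {i}. f l x))) (at x)"
  using has_derivative_prod[of I f "\<lambda>i y. y *\<^sub>R f' i" x UNIV] assms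
  unfolding has_vector_derivative_def by (simp add: scaleR_sum_right)

text \<open>Divided powers lower their index under differentiation without a numerical factor. The
  case \<open>n = 0\<close> is separate because \<open>n - 1\<close> is then 0 again and would leave
  a spurious term \<open>w'\<close>.\<close>

lemma has_vector_derivative_power_fact:
  fixes w :: "real \<Rightarrow> complex"
  assumes "(w has_vector_derivative w') (at x)"
  shows "((\<lambda>x. w x ^ n / fact n) has_vector_derivative
    (if n = 0 then 0 else w' * (w x ^ (n - 1) / fact (n - 1)))) (at x)"
proof (cases n)
  case (Suc m)
  have "((\<lambda>z. z ^ n / fact n) has_field_derivative w x ^ m / fact m) (at (w x))"
    using DERIV_cdivide[OF DERIV_power[OF DERIV_ident[of "at (w x)"], of n], of "fact n"] Suc
    by (simp add: divide_simps del: of_nat_Suc)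
  from field_vector_diff_chain_at[OF assms this] Suc show ?thesis by (simp add: o_def)
qed simp

lemma bell_monom_has_vector_derivative:
  assumes "\<And>i. i \<in> {1..N} \<Longrightarrow> (w i has_vector_derivative w' i) (at x)"
  shows "((\<lambda>x. bell_monom N j (\<lambda>i. w i x)) has_vector_derivative
    (\<Sum>i\<in>{i\<in>{1..N}. j i > 0}. w' i * bell_monom N (decr i j) (\<lambda>i. w i x))) (at x)"
proof -
  let ?d = "\<lambda>i. if j i = 0 then 0 else w' i * (w i x ^ (j i - 1) / fact (j i - 1))"
  have "((\<lambda>x. bell_monom N j (\<lambda>i. w i x)) has_vector_derivative
    (\<Sum>i=1..N. ?d i * (\<Prod>l\<in>{1..N} - {i}. w l x ^ j l / fact (j l)))) (at x)"
    unfolding bell_monom_def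
    by (intro has_vector_derivative_prod has_vector_derivative_power_fact assms)
  also have "(\<Sum>i=1..N. ?d i * (\<Prod>l\<in>{1..N} - {i}. w l x ^ j l / fact (j l))) =
     (\<Sum>i\<in>{i\<in>{1..N}. j i > 0}. w' i * bell_monom N (decr i j) (\<lambda>i. w i x))"
  proof (rule sum.mono_neutral_cong_right)
    fix i assume i: "i \<in> {i\<in>{1..N}. j i > 0}"
    have "(\<Prod>l\<in>{1..N} - {i}. w l x ^ decr i j l / fact (decr i j l)) = (\<Prod>l\<in>{1..N} - {i}. w l x ^ j l / fact (j l))"
      by (intro prod.cong) (auto simp: decr_def)
    then show "?d i * (\<Prod>l\<in>{1..N} - {i}. w l x ^ j l / fact (j l)) =
        w' i * bell_monom N (decr i j) (\<lambda>i. w i x)"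
      using i bell_monom_remove[of i N "decr i j" "\<lambda>i. w i x"] by (simp add: decr_def)
  qed auto
  finally show ?thesis .
qed

text \<open>Both sides are sums over the exponents \<open>j\<close> of a monomial with one factor \<open>w i\<close> replaced by
  \<open>(i + 1) * w (i + 1)\<close>, counted by the pair of exponents before and after the replacement.\<close>

lemma bell_sum_shift:
  assumes "n < N"
  shows "(\<Sum>j\<in>bell_exponents N n k. \<Sum>i\<in>{i\<in>{1..N}. j i > 0}.
      (of_nat (Suc i) * w (Suc i)) * bell_monom N (decr i j) w) =
    (\<Sum>j\<in>bell_exponents N (Suc n) k. (of_nat (Suc n) - of_nat (j 1)) * bell_monom N j w)"
proof -
  let ?P = "SIGMA j:bell_exponents N n k. {i\<in>{1..N}. j i > 0}"
  let ?Q = "SIGMA j:bell_exponents N (Suc n) k. {i\<in>{2..N}. j i > 0}"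
  have "(\<Sum>j\<in>bell_exponents N n k. \<Sum>i\<in>{i\<in>{1..N}. j i > 0}.
      (of_nat (Suc i) * w (Suc i)) * bell_monom N (decr i j) w) =
    (\<Sum>(j, i)\<in>?P. (of_nat (Suc i) * w (Suc i)) * bell_monom N (decr i j) w)"
    by (intro sum.Sigma) (auto simp: finite_bell_exponents)
  also have "\<dots> = (\<Sum>(j, i)\<in>?Q. of_nat (i * j i) * bell_monom N j w)"
  proof (rule sum.reindex_bij_witness[of _ "\<lambda>(j, i). (incr (i - 1) (decr i j), i - 1)"
        "\<lambda>(j, i). (incr (Suc i) (decr i j), Suc i)"])
    fix a assume "a \<in> ?P"
    then obtain j i where a: "a = (j, i)" and j: "j \<in> bell_exponents N n k" "j i > 0" by auto
    note b = bell_exponents_bound[OF j]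
    have i: "Suc i \<in> {1..N}" using b assms by auto
    show "(case (case a of (j, i) \<Rightarrow> (incr (Suc i) (decr i j), Suc i)) of
        (j, i) \<Rightarrow> (incr (i - 1) (decr i j), i - 1)) = a"
      by (simp add: a incr_decr j)
    have "incr (Suc i) (decr i j) \<in> bell_exponents N (Suc n) k"
      using incr_exponents[OF i, of "decr i j" "n - i" "k - 1"] decr_exponents[OF j] b by simp
    then show "(case a of (j, i) \<Rightarrow> (incr (Suc i) (decr i j), Suc i)) \<in> ?Q"
      using i b by (auto simp: a)
    show "(case (case a of (j, i) \<Rightarrow> (incr (Suc i) (decr i j), Suc i)) of
        (j, i) \<Rightarrow> of_nat (i * j i) * bell_monom N j w) =
        (case a of (j, i) \<Rightarrow> (of_nat (Suc i) * w (Suc i)) * bell_monom N (decr i j) w)"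
      using bell_monom_incr[OF i, of w "decr i j"]
      by (simp add: a incr_def mult.assoc del: of_nat_Suc)
  next
    fix a assume "a \<in> ?Q"
    then obtain j i where a: "a = (j, i)" and j: "j \<in> bell_exponents N (Suc n) k" "j i > 0"
      and i: "i \<in> {2..N}" by auto
    note b = bell_exponents_bound[OF j]
    have i': "i - 1 \<in> {1..N}" "Suc (i - 1) = i" using i by auto
    show "(case (case a of (j, i) \<Rightarrow> (incr (i - 1) (decr i j), i - 1)) of
        (j, i) \<Rightarrow> (incr (Suc i) (decr i j), Suc i)) = a"
      using i' by (simp add: a incr_decr j)
    have "incr (i - 1) (decr i j) \<in> bell_exponents N n k"
      using incr_exponents[OF i'(1), of "decr i j" "Suc n - i" "k - 1"] decr_exponents[OF j] b i
      by (simp add: Suc_diff_le)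
    then show "(case a of (j, i) \<Rightarrow> (incr (i - 1) (decr i j), i - 1)) \<in> ?P"
      using i' by (auto simp: a)
  qed
  also have "\<dots> = (\<Sum>j\<in>bell_exponents N (Suc n) k. \<Sum>i\<in>{i\<in>{2..N}. j i > 0}. of_nat (i * j i) * bell_monom N j w)"
    by (intro sum.Sigma[symmetric]) (auto simp: finite_bell_exponents)
  also have "\<dots> = (\<Sum>j\<in>bell_exponents N (Suc n) k. (of_nat (Suc n) - of_nat (j 1)) * bell_monom N j w)"
  proof (rule sum.cong[OF refl])
    fix j assume j: "j \<in> bell_exponents N (Suc n) k"
    \<comment> \<open>Index 1 never results from a replacement, so only indices from 2 on
      contribute, with total weight \<open>n + 1 - j 1\<close>.\<close>
    have "Suc n = (\<Sum>i=1..N. i * j i)" using j by (auto simp: bell_exponents_def)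
    also have "\<dots> = j 1 + (\<Sum>i=2..N. i * j i)"
      using assms by (subst sum.atLeast_Suc_atMost) (auto simp: numeral_2_eq_2)
    also have "(\<Sum>i=2..N. i * j i) = (\<Sum>i\<in>{i\<in>{2..N}. j i > 0}. i * j i)"
      by (rule sum.mono_neutral_right) auto
    finally have "of_nat (Suc n) = (of_nat (j 1) + (\<Sum>i\<in>{i\<in>{2..N}. j i > 0}. of_nat (i * j i)) :: complex)"
      by (metis of_nat_add of_nat_sum)
    then show "(\<Sum>i\<in>{i\<in>{2..N}. j i > 0}. of_nat (i * j i) * bell_monom N j w) =
        (of_nat (Suc n) - of_nat (j 1)) * bell_monom N j w"
      by (simp add: sum_distrib_right del: of_nat_mult)
  qed
  finally show ?thesis .
qed

text \<open>Multiplying by \<open>w 1\<close> raises \<open>j 1\<close>, and the divided power turns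
  this into the factor \<open>j 1\<close>. Exponents with \<open>j 1 = 0\<close> are not reached,
  but their factor is zero.\<close>

lemma bell_sum_first:
  assumes "N \<ge> 1"
  shows "(\<Sum>j\<in>bell_exponents N (Suc n) (Suc k). of_nat (j 1) * bell_monom N j w) = w 1 * bell_sum N n k w"
proof -
  have "w 1 * bell_sum N n k w = (\<Sum>j\<in>bell_exponents N n k. of_nat (Suc (j 1)) * bell_monom N (incr 1 j) w)"
    using assms bell_monom_incr[of 1 N w] by (simp add: bell_sum_def sum_distrib_left)
  also have "\<dots> = (\<Sum>j\<in>{j\<in>bell_exponents N (Suc n) (Suc k). j 1 > 0}. of_nat (j 1) * bell_monom N j w)"
    using incr_exponents[of 1 N _ n k] decr_exponents[of _ N "Suc n" "Suc k" 1] assms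
    by (intro sum.reindex_bij_witness[of _ "decr 1" "incr 1"]) (auto simp: incr_decr, auto simp: incr_def)
  also have "\<dots> = (\<Sum>j\<in>bell_exponents N (Suc n) (Suc k). of_nat (j 1) * bell_monom N j w)"
    by (rule sum.mono_neutral_left) (auto simp: finite_bell_exponents)
  finally show ?thesis by simp
qed

lemma bell_exponents_0: "bell_exponents N (Suc n) 0 = {}"
proof -
  have False if "j \<in> bell_exponents N (Suc n) 0" for j
  proof -
    have "(\<Sum>i=1..N. i * j i) = 0" using that by (auto simp: bell_exponents_def)
    with that show False by (auto simp: bell_exponents_def)
  qed
  then show ?thesis by blast
qed

text \<open>The hypothesis on \<open>w\<close> is the rule satisfied by the Taylor coefficients of a
  function. The shift counts each monomial of weight \<open>n + 1\<close> with factor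
  \<open>n + 1 - j 1\<close>; the part with \<open>j 1\<close> is \<open>w 1\<close> times the sum
  of degree \<open>k - 1\<close>.\<close>

lemma bell_sum_has_vector_derivative:
  fixes w :: "nat \<Rightarrow> real \<Rightarrow> complex"
  assumes "\<And>i. (w i has_vector_derivative of_nat (Suc i) * w (Suc i) x) (at x)" and "n < N"
  shows "((\<lambda>x. bell_sum N n k (\<lambda>i. w i x)) has_vector_derivative
     of_nat (Suc n) * bell_sum N (Suc n) k (\<lambda>i. w i x) -
       w 1 x * (if k = 0 then 0 else bell_sum N n (k - 1) (\<lambda>i. w i x))) (at x)"
proof -
  let ?w = "\<lambda>i. w i x"
  have "((\<lambda>x. bell_sum N n k (\<lambda>i. w i x)) has_vector_derivative
     (\<Sum>j\<in>bell_exponents N n k. \<Sum>i\<in>{i\<in>{1..N}. j i > 0}.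
       (of_nat (Suc i) * w (Suc i) x) * bell_monom N (decr i j) ?w)) (at x)"
    unfolding bell_sum_def by (intro has_vector_derivative_sum bell_monom_has_vector_derivative assms)
  also have "(\<Sum>j\<in>bell_exponents N n k. \<Sum>i\<in>{i\<in>{1..N}. j i > 0}.
       (of_nat (Suc i) * w (Suc i) x) * bell_monom N (decr i j) ?w) =
     of_nat (Suc n) * bell_sum N (Suc n) k ?w -
     (\<Sum>j\<in>bell_exponents N (Suc n) k. of_nat (j 1) * bell_monom N j ?w)"
    using bell_sum_shift[OF assms(2), where k = k and w = ?w]
    by (simp only: left_diff_distrib sum_subtractf sum_distrib_left bell_sum_def)
  also have "(\<Sum>j\<in>bell_exponents N (Suc n) k. of_nat (j 1) * bell_monom N j ?w) =
     w 1 x * (if k = 0 then 0 else bell_sum N n (k - 1) ?w)"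
    using bell_sum_first[where N = N and n = n and k = "k - 1" and w = ?w] assms(2) by (cases k) (auto simp: bell_exponents_0)
  finally show ?thesis .
qed

lemma bell_deriv_has_vector_derivative:
  assumes "\<And>i. hderiv i g differentiable at x"
  shows "(bell_deriv g n k has_vector_derivative bell_deriv g (Suc n) k x -
     of_real (vd g x) * (if k = 0 then 0 else bell_deriv g n (k - 1) x)) (at x)"
proof -
  let ?w = "\<lambda>i x. complex_of_real (hderiv i g x) / fact i"
  have w: "(?w i has_vector_derivative of_nat (Suc i) * ?w (Suc i) x) (at x)" for i
    using bounded_linear.has_vector_derivative[OF bounded_linear_divide vd_of_real[OF assms[of i]], of "fact i"]
    by (simp add: hderiv_Suc divide_simps del: of_nat_Suc)
  \<comment> \<open>The index bound \<open>n + 2\<close> serves both \<open>n\<close> and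
    \<open>n + 1\<close>, whatever \<open>k'\<close> is.\<close>
  have eq: "bell_deriv g n' k' = (\<lambda>x. fact n' * bell_sum (Suc (Suc n)) n' k' (\<lambda>i. ?w i x))" if "n' \<le> Suc n" for n' k'
    unfolding bell_deriv_def using that by (intro ext bell_eq_bell_sum) simp
  have "((\<lambda>x. fact n * bell_sum (Suc (Suc n)) n k (\<lambda>i. ?w i x)) has_vector_derivative
     fact n * (of_nat (Suc n) * bell_sum (Suc (Suc n)) (Suc n) k (\<lambda>i. ?w i x) -
       ?w 1 x * (if k = 0 then 0 else bell_sum (Suc (Suc n)) n (k - 1) (\<lambda>i. ?w i x)))) (at x)"
    by (intro has_vector_derivative_mult_right bell_sum_has_vector_derivative w) simp
  then show ?thesis
    by (cases k) (simp_all add: eq algebra_simps)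
qed

text \<open>Values outside \<open>1 \<le> k \<le> n\<close> serve as boundary values of the
  recurrence. No exponent has degree above its weight, so here the sum is empty.\<close>

lemma bell_deriv_eq_0: "n < k \<Longrightarrow> bell_deriv g n k x = 0"
  using bell_eq_bell_sum[of n k "Suc n"] bell_exponents_le[of _ "Suc n" n k]
  by (fastforce simp: bell_deriv_def bell_sum_def)

lemma bell_deriv_Suc_0: "bell_deriv g (Suc n) 0 x = 0"
  using bell_eq_bell_sum[of "Suc n" 0 "Suc (Suc n)"]
  by (simp add: bell_deriv_def bell_sum_def bell_exponents_0)

lemma bell_deriv_0_0: "bell_deriv g 0 0 x = 1"
proof -
  have "bell_exponents 1 0 0 = {\<lambda>_. 0}" by (auto simp: bell_exponents_def fun_eq_iff) (metis One_nat_def)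
  then show ?thesis
    using bell_eq_bell_sum[of 0 0 1] by (simp add: bell_deriv_def bell_sum_def bell_monom_def)
qed

text \<open>One place above the diagonal \<open>L\<close> vanishes identically, and so does its
  derivative; the recurrence there reads \<open>L_{n+1,n+1} = g' L_{n,n}\<close>.\<close>

lemma bell_deriv_diag:
  assumes "\<And>i. hderiv i g differentiable at x"
  shows "bell_deriv g n n x = of_real (vd g x) ^ n"
proof (induction n)
  case (Suc n)
  have "bell_deriv g n (Suc n) = (\<lambda>x. 0)" by (simp add: bell_deriv_eq_0 fun_eq_iff)
  then have "bell_deriv g (Suc n) (Suc n) x - of_real (vd g x) * bell_deriv g n n x = 0"
    using vector_derivative_at[OF bell_deriv_has_vector_derivative[OF assms, of n "Suc n"]] by simp
  with Suc show ?case by simp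
qed (simp add: bell_deriv_0_0)

lemma sum_telescope_Suc: "(\<Sum>k\<le>n. a (Suc k) - a k) = a (Suc n) - (a 0 :: 'a :: ab_group_add)"
  by (induction n) auto

text \<open>The product rule at \<open>k\<close> yields \<open>g' f^(k+1)(g) L_{n,k}\<close> and,
  through the recurrence, \<open>- g' f^(k)(g) L_{n,k-1}\<close>. These are
  \<open>?a (Suc k)\<close> and \<open>- ?a k\<close>, so they telescope to the top term, which is
  the missing summand with index \<open>n + 1\<close>.\<close>

lemma faa_di_bruno_step:
  fixes f :: "real \<Rightarrow> complex" and g :: "real \<Rightarrow> real"
  assumes f: "\<And>k. k \<le> n \<Longrightarrow> hderiv k f differentiable at (g x)"
    and g: "\<And>i. hderiv i g differentiable at x"
  shows "((\<lambda>x. \<Sum>k\<le>n. hderiv k f (g x) * bell_deriv g n k x) has_vector_derivative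
    (\<Sum>k\<le>Suc n. hderiv k f (g x) * bell_deriv g (Suc n) k x)) (at x)"
proof -
  let ?a = "\<lambda>k. if k = 0 then 0 else hderiv k f (g x) * (of_real (vd g x) * bell_deriv g n (k - 1) x)"
  have "((\<lambda>x. hderiv k f (g x)) has_vector_derivative of_real (vd g x) * hderiv (Suc k) f (g x)) (at x)"
    if "k \<le> n" for k
    using vector_diff_chain_at[OF vector_derivative_has[of g x] vector_derivative_has[OF f[OF that]]] g[of 0]
    by (simp add: o_def scaleR_conv_of_real hderiv_Suc)
  then have "((\<lambda>x. \<Sum>k\<le>n. hderiv k f (g x) * bell_deriv g n k x) has_vector_derivative
    (\<Sum>k\<le>n. hderiv k f (g x) * (bell_deriv g (Suc n) k x -
       of_real (vd g x) * (if k = 0 then 0 else bell_deriv g n (k - 1) x)) +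
       of_real (vd g x) * hderiv (Suc k) f (g x) * bell_deriv g n k x)) (at x)"
    by (intro has_vector_derivative_sum has_vector_derivative_mult bell_deriv_has_vector_derivative g) auto
  also have "(\<Sum>k\<le>n. hderiv k f (g x) * (bell_deriv g (Suc n) k x -
       of_real (vd g x) * (if k = 0 then 0 else bell_deriv g n (k - 1) x)) +
       of_real (vd g x) * hderiv (Suc k) f (g x) * bell_deriv g n k x) =
     (\<Sum>k\<le>n. hderiv k f (g x) * bell_deriv g (Suc n) k x + (?a (Suc k) - ?a k))"
    by (intro sum.cong) (auto simp: algebra_simps)
  also have "\<dots> = (\<Sum>k\<le>n. hderiv k f (g x) * bell_deriv g (Suc n) k x) + (\<Sum>k\<le>n. ?a (Suc k) - ?a k)"
    by (rule sum.distrib)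
  also have "(\<Sum>k\<le>n. ?a (Suc k) - ?a k) = ?a (Suc n) - ?a 0"
    by (rule sum_telescope_Suc)
  also have "?a (Suc n) - ?a 0 = hderiv (Suc n) f (g x) * bell_deriv g (Suc n) (Suc n) x"
    using bell_deriv_diag[OF g] by simp
  finally show ?thesis by simp
qed

text \<open>The formula reaches \<open>n = m\<close> while only derivatives of \<open>f\<close> of
  order below \<open>m\<close> are differentiable, since the last differentiation needs no more.
  This is the regularity that \<open>solves_ode\<close> provides.\<close>

lemma faa_di_bruno:
  fixes f :: "real \<Rightarrow> complex" and g :: "real \<Rightarrow> real"
  assumes f: "\<And>k y. k < m \<Longrightarrow> y > c \<Longrightarrow> hderiv k f differentiable at y"
    and g: "\<And>i x. x > b \<Longrightarrow> hderiv i g differentiable at x" "\<And>x. x > b \<Longrightarrow> g x > c"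
    and "x > b"
  shows "n \<le> m \<Longrightarrow> hderiv n (\<lambda>x. f (g x)) x = (\<Sum>k\<le>n. hderiv k f (g x) * bell_deriv g n k x)"
    and "n < m \<Longrightarrow> hderiv n (\<lambda>x. f (g x)) differentiable at x"
proof -
  have eq: "hderiv n (\<lambda>x. f (g x)) x = (\<Sum>k\<le>n. hderiv k f (g x) * bell_deriv g n k x)" if "n \<le> m" "x > b" for n x
    using that
  proof (induction n arbitrary: x)
    case 0
    then show ?case by (simp add: bell_deriv_0_0)
  next
    case (Suc n)
    have "hderiv (Suc n) (\<lambda>x. f (g x)) x = vd (\<lambda>x. \<Sum>k\<le>n. hderiv k f (g x) * bell_deriv g n k x) x"
      unfolding hderiv_Suc by (rule vd_transform[of b]) (use Suc in auto)
    also have "\<dots> = (\<Sum>k\<le>Suc n. hderiv k f (g x) * bell_deriv g (Suc n) k x)"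
      using Suc.prems f g by (intro vector_derivative_at faa_di_bruno_step) auto
    finally show ?case .
  qed
  show "n \<le> m \<Longrightarrow> hderiv n (\<lambda>x. f (g x)) x = (\<Sum>k\<le>n. hderiv k f (g x) * bell_deriv g n k x)"
    using eq assms(4) by blast
  show "hderiv n (\<lambda>x. f (g x)) differentiable at x" if "n < m"
  proof (rule differentiable_transform)
    show "(\<lambda>x. \<Sum>k\<le>n. hderiv k f (g x) * bell_deriv g n k x) differentiable at x"
      using that f g assms(4) by (intro differentiableI_vector[OF faa_di_bruno_step]) auto
  qed (use eq that assms(4) in auto)
qed

section \<open>The transformed differential equation\<close>

text \<open>A limit of \<open>f / x^d\<close> alone says nothing about \<open>f'\<close>; the
  derivative of the remainder is controlled because it is again expandable, of order
  \<open>d - 2\<close>.\<close>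

lemma expandable_leading_vd:
  assumes "expandable d f" "leading d f c"
  shows "leading (d - 1) (vd f) (of_int d * c)"
proof (rule symbol_leading)
  have "expandable (d - 1 - 1) (vd (\<lambda>x. f x - c * pw d x))"
    by (rule expandable_vd[OF expandable_leading_step[OF assms]])
  moreover have "\<forall>\<^sub>F x in at_top. vd (\<lambda>x. f x - c * pw d x) x = vd f x - (of_int d * c) * pw (d - 1) x"
    using symbol_differentiable[OF expandable_symbol[OF assms(1)]] eventually_gt_at_top[of 0]
  proof eventually_elim
    case (elim x)
    then have "((\<lambda>x. f x - c * pw d x) has_vector_derivative vd f x - c * (of_int d * pw (d - 1) x)) (at x)"
      by (intro has_vector_derivative_diff has_vector_derivative_mult_right
          pw_has_vector_derivative vector_derivative_has)
    then show ?case by (simp add: vector_derivative_at mult_ac)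
  qed
  ultimately show "symbol (d - 1 - 1) (\<lambda>x. vd f x - (of_int d * c) * pw (d - 1) x)"
    by (rule expandable_symbol[OF expandable_cong])
qed

text \<open>For \<open>k = m\<close> the sum is empty, so the formula for the top coefficient is an
  instance, by \<open>L_{m,m} = g'^m\<close>.\<close>

function ode_coeff :: "(nat \<Rightarrow> real \<Rightarrow> complex) \<Rightarrow> (real \<Rightarrow> real) \<Rightarrow> nat \<Rightarrow> nat \<Rightarrow> real \<Rightarrow> complex" where
  "ode_coeff p g m k x = p k (g x) / bell_deriv g k k x
     - (\<Sum>n=k+1..m. ode_coeff p g m n x * (bell_deriv g n k x / bell_deriv g k k x))"
  by auto
termination by (relation "Wellfounded.measure (\<lambda>(p, g, m, k, x). m - k)") auto

declare ode_coeff.simps [simp del]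

section \<open>Composition of smooth functions and of the differential equation\<close>

definition smooth_beyond :: "real \<Rightarrow> (real \<Rightarrow> real) \<Rightarrow> bool" where
  "smooth_beyond b g \<longleftrightarrow> (\<forall>x>b. (\<forall>k. hderiv k g differentiable at x) \<and>
     vd (\<lambda>x. complex_of_real (g x)) x = of_real (vd g x))"

lemma smooth_beyond_exists:
  assumes "smooth_at_top (\<lambda>x. complex_of_real (g x))"
  shows "\<exists>b. smooth_beyond b g"
  using smooth_at_top_of_real[OF assms] unfolding smooth_beyond_def
  by (metis hderiv_1)

lemma smooth_at_top_compose:
  fixes f :: "real \<Rightarrow> complex" and g :: "real \<Rightarrow> real"
  assumes "smooth_at_top f" "smooth_beyond b g" "filterlim g at_top at_top"
  shows "smooth_at_top (\<lambda>x. f (g x))"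
proof -
  obtain c where c: "\<And>k y. y > c \<Longrightarrow> hderiv k f differentiable at y"
    using assms(1) by (auto simp: smooth_at_top_iff)
  obtain a where a: "\<And>x. x > a \<Longrightarrow> g x > c"
    using assms(3) by (auto simp: filterlim_at_top_dense eventually_at_top_dense)
  \<comment> \<open>Taking \<open>m = k + 1\<close> reaches order \<open>k\<close>, on a half-line
    that does not depend on \<open>k\<close>.\<close>
  have "hderiv k (\<lambda>x. f (g x)) differentiable at x" if "x > max a b" for x k
    by (rule faa_di_bruno(2)[where m = "Suc k" and b = "max a b" and c = c and f = f and g = g])
       (use that assms(2) a c in \<open>auto simp: smooth_beyond_def\<close>)
  then show ?thesis unfolding smooth_at_top_iff by blast
qed

text \<open>The recursion is the \<open>k\<close>-th equation of a triangular system solved for its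
  diagonal unknown; multiplying back by \<open>L_{k,k}\<close> restores the equation.\<close>

lemma sum_ode_coeff:
  assumes "bell_deriv g k k x \<noteq> 0" "k \<in> {1..m}"
  shows "(\<Sum>n=k..m. ode_coeff p g m n x * bell_deriv g n k x) = p k (g x)"
proof -
  have "(\<Sum>n=k..m. ode_coeff p g m n x * bell_deriv g n k x) =
     ode_coeff p g m k x * bell_deriv g k k x + (\<Sum>n=k+1..m. ode_coeff p g m n x * bell_deriv g n k x)"
    using assms by (simp add: sum.atLeast_Suc_atMost)
  also have "ode_coeff p g m k x * bell_deriv g k k x =
     p k (g x) - (\<Sum>n=k+1..m. ode_coeff p g m n x * bell_deriv g n k x)"
    using assms by (subst ode_coeff.simps) (simp add: left_diff_distrib sum_distrib_right)
  finally show ?thesis by simp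
qed

lemma solves_ode_compose:
  assumes ode: "solves_ode m p f" and g: "smooth_beyond b g" "filterlim g at_top at_top"
    and nz: "\<forall>\<^sub>F x in at_top. vd g x \<noteq> 0"
  shows "solves_ode m (ode_coeff p g m) (\<lambda>x. f (g x))"
proof -
  obtain c where c: "\<And>k y. y > c \<Longrightarrow> k < m \<Longrightarrow> hderiv k f differentiable at y"
     "\<And>y. y > c \<Longrightarrow> f y = (\<Sum>k=1..m. p k y * hderiv k f y)"
    using ode by (auto simp: solves_ode_def eventually_at_top_dense)
  obtain a where a: "\<And>x. x > a \<Longrightarrow> g x > c"
    using g by (auto simp: filterlim_at_top_dense eventually_at_top_dense)
  have fdb: "n \<le> m \<Longrightarrow> hderiv n (\<lambda>x. f (g x)) x = (\<Sum>k\<le>n. hderiv k f (g x) * bell_deriv g n k x)"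
    "n < m \<Longrightarrow> hderiv n (\<lambda>x. f (g x)) differentiable at x" if "x > max a b" for n x
    using that g a c
      faa_di_bruno[where m = m and b = "max a b" and c = c and f = f and g = g and x = x and n = n]
    by (auto simp: smooth_beyond_def)
  have "f (g x) = (\<Sum>n=1..m. ode_coeff p g m n x * hderiv n (\<lambda>x. f (g x)) x)"
    if x: "x > max a b" "vd g x \<noteq> 0" for x
  proof -
    have L: "bell_deriv g k k x \<noteq> 0" for k
      using bell_deriv_diag[of g x k] x g by (simp add: smooth_beyond_def)
    have h: "hderiv n (\<lambda>x. f (g x)) x = (\<Sum>k=1..m. hderiv k f (g x) * bell_deriv g n k x)" if n: "n \<in> {1..m}" for n
    proof -
      have "(\<Sum>k\<le>n. hderiv k f (g x) * bell_deriv g n k x) = (\<Sum>k\<in>{..m}. hderiv k f (g x) * bell_deriv g n k x)"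
        using n by (intro sum.mono_neutral_left) (auto simp: bell_deriv_eq_0)
      also have "\<dots> = (\<Sum>k=1..m. hderiv k f (g x) * bell_deriv g n k x)"
        using n bell_deriv_Suc_0[of g "n - 1"]
        by (intro sum.mono_neutral_right) (auto simp: not_less_eq_eq)
      finally show ?thesis using fdb(1)[OF x(1)] n by simp
    qed
    have "(\<Sum>n=1..m. ode_coeff p g m n x * hderiv n (\<lambda>x. f (g x)) x) =
       (\<Sum>n=1..m. \<Sum>k=1..m. hderiv k f (g x) * (ode_coeff p g m n x * bell_deriv g n k x))"
      by (intro sum.cong refl) (simp add: h sum_distrib_left mult_ac)
    \<comment> \<open>Interchanging the sums collects the coefficient of the \<open>k\<close>-th
      derivative of \<open>f\<close> at \<open>g x\<close>, which the triangular system makes equal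
      to \<open>p k (g x)\<close>.\<close>
    also have "\<dots> = (\<Sum>k=1..m. hderiv k f (g x) * (\<Sum>n=1..m. ode_coeff p g m n x * bell_deriv g n k x))"
      by (subst sum.swap) (simp add: sum_distrib_left)
    also have "\<dots> = (\<Sum>k=1..m. hderiv k f (g x) * p k (g x))"
    proof (intro sum.cong refl)
      fix k assume k: "k \<in> {1..m}"
      have "(\<Sum>n=1..m. ode_coeff p g m n x * bell_deriv g n k x) = (\<Sum>n=k..m. ode_coeff p g m n x * bell_deriv g n k x)"
        using k by (intro sum.mono_neutral_right) (auto simp: bell_deriv_eq_0)
      then show "hderiv k f (g x) * (\<Sum>n=1..m. ode_coeff p g m n x * bell_deriv g n k x) = hderiv k f (g x) * p k (g x)"
        using sum_ode_coeff[OF L k] by simp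
    qed
    also have "\<dots> = f (g x)" using c(2)[OF a] x by (simp add: mult.commute)
    finally show ?thesis by simp
  qed
  then show ?thesis
    unfolding solves_ode_def
    by (intro eventually_mono[OF eventually_conj[OF nz eventually_gt_at_top[of "max a b"]]])
       (use fdb(2) in blast)
qed

text \<open>Inverses are left out: the only divisions are by powers of \<open>g'\<close>, and
  membership of \<open>1 / g'\<close> is assumed where it is used. Orders are upper bounds, so
  cancellation does no harm.\<close>

locale graded_functions =
  fixes Y :: "int \<Rightarrow> (real \<Rightarrow> complex) set"
  assumes cong: "f \<in> Y d \<Longrightarrow> \<forall>\<^sub>F x in at_top. f x = h x \<Longrightarrow> h \<in> Y d"
    and mono: "d \<le> e \<Longrightarrow> Y d \<subseteq> Y e"
    and zero: "(\<lambda>x. 0) \<in> Y d"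
    and one: "(\<lambda>x. 1) \<in> Y 0"
    and add: "f \<in> Y d \<Longrightarrow> h \<in> Y d \<Longrightarrow> (\<lambda>x. f x + h x) \<in> Y d"
    and scale: "f \<in> Y d \<Longrightarrow> (\<lambda>x. a * f x) \<in> Y d"
    and mult: "f \<in> Y d \<Longrightarrow> h \<in> Y e \<Longrightarrow> (\<lambda>x. f x * h x) \<in> Y (d + e)"
    and vd: "f \<in> Y d \<Longrightarrow> vd f \<in> Y (d - 1)"
begin

lemma diff: "f \<in> Y d \<Longrightarrow> h \<in> Y d \<Longrightarrow> (\<lambda>x. f x - h x) \<in> Y d"
  using add[OF _ scale[of h d "-1"], of f] by simp

lemma sum: "(\<And>i. i \<in> I \<Longrightarrow> h i \<in> Y d) \<Longrightarrow> (\<lambda>x. \<Sum>i\<in>I. h i x) \<in> Y d"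
  by (induction I rule: infinite_finite_induct) (auto intro: zero add)

lemma power: "f \<in> Y d \<Longrightarrow> (\<lambda>x. f x ^ n) \<in> Y (int n * d)"
proof (induction n)
  case (Suc n)
  then show ?case using mult[of f d "\<lambda>x. f x ^ n" "int n * d"] by (simp add: algebra_simps)
qed (simp add: one)

text \<open>In \<open>L_{n+1,k} = L_{n,k}' + g' L_{n,k-1}\<close>, differentiation costs one order,
  and \<open>g'\<close> of order \<open>s - 1\<close> times order \<open>s (k - 1) - n\<close> is
  again of order \<open>s k - (n + 1)\<close>.\<close>

lemma bell_deriv:
  assumes g: "smooth_beyond b g" "(\<lambda>x. of_real (g x)) \<in> Y s"
  shows "bell_deriv g n k \<in> Y (s * int k - int n)"
proof (induction n arbitrary: k)
  case 0
  have "bell_deriv g 0 k = (if k = 0 then (\<lambda>x. 1) else (\<lambda>x. 0))"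
    by (simp add: fun_eq_iff bell_deriv_0_0 bell_deriv_eq_0)
  then show ?case by (auto simp: zero one)
next
  case (Suc n)
  show ?case
  proof (cases k)
    case 0
    then have "bell_deriv g (Suc n) k = (\<lambda>x. 0)" by (simp add: fun_eq_iff bell_deriv_Suc_0)
    then show ?thesis by (simp add: zero)
  next
    case k: (Suc l)
    have "(\<lambda>x. vd (bell_deriv g n k) x + vd (\<lambda>x. of_real (g x)) x * bell_deriv g n l x) \<in> Y (s * int k - int (Suc n))"
    proof (rule add)
      show "vd (bell_deriv g n k) \<in> Y (s * int k - int (Suc n))"
        using vd[OF Suc[of k]] by (simp add: algebra_simps)
      show "(\<lambda>x. vd (\<lambda>x. of_real (g x)) x * bell_deriv g n l x) \<in> Y (s * int k - int (Suc n))"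
        using mult[OF vd[OF g(2)] Suc[of l]] by (simp add: algebra_simps k)
    qed
    then show ?thesis
    proof (rule cong)
      show "\<forall>\<^sub>F x in at_top. vd (bell_deriv g n k) x + vd (\<lambda>x. of_real (g x)) x * bell_deriv g n l x =
          bell_deriv g (Suc n) k x"
        using eventually_gt_at_top[of b]
      proof eventually_elim
        case (elim x)
        then show ?case
          using g(1) vector_derivative_at[OF bell_deriv_has_vector_derivative[of g x n k]]
          by (simp add: smooth_beyond_def k)
      qed
    qed
  qed
qed

text \<open>The excess \<open>D\<close> passes through unchanged: \<open>L_{l,n}\<close> has order
  \<open>s n - l\<close> and \<open>1 / L_{n,n}\<close> order \<open>n (1 - s)\<close>, so a
  coefficient of order \<open>D + l\<close> contributes order \<open>D + n\<close>, as does
  \<open>p n (g x)\<close> divided by \<open>L_{n,n}\<close>. The single step is separate because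
  the finer bound on \<open>r k\<close> uses the actual orders of the later coefficients.\<close>

lemma ode_coeff_step:
  assumes g: "smooth_beyond b g" "(\<lambda>x. of_real (g x)) \<in> Y s"
    and inv: "(\<lambda>x. inverse (vd (\<lambda>x. complex_of_real (g x)) x)) \<in> Y (1 - s)"
    and p: "(\<lambda>x. p n (g x)) \<in> Y (D + s * int n)"
    and \<pi>: "\<And>l. l \<in> {n+1..m} \<Longrightarrow> ode_coeff p g m l \<in> Y (D + int l)"
  shows "ode_coeff p g m n \<in> Y (D + int n)"
proof -
  have inv_diag: "(\<lambda>x. inverse (bell_deriv g n n x)) \<in> Y (int n * (1 - s))"
    using power[OF inv, of n]
  proof (rule cong)
    show "\<forall>\<^sub>F x in at_top. inverse (vd (\<lambda>x. complex_of_real (g x)) x) ^ n = inverse (bell_deriv g n n x)"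
      using eventually_gt_at_top[of b]
      by eventually_elim (use g(1) in \<open>simp add: smooth_beyond_def bell_deriv_diag power_inverse\<close>)
  qed
  have "(\<lambda>x. p n (g x) * inverse (bell_deriv g n n x)) \<in> Y (D + int n)"
    using mult[OF p inv_diag] by (simp add: algebra_simps)
  moreover have "(\<lambda>x. ode_coeff p g m l x * (bell_deriv g l n x * inverse (bell_deriv g n n x))) \<in> Y (D + int n)"
    if "l \<in> {n+1..m}" for l
    using mult[OF \<pi>[OF that] mult[OF bell_deriv[OF g, of l n] inv_diag]] by (simp add: algebra_simps)
  ultimately have "(\<lambda>x. p n (g x) * inverse (bell_deriv g n n x) -
     (\<Sum>l=n+1..m. ode_coeff p g m l x * (bell_deriv g l n x * inverse (bell_deriv g n n x)))) \<in> Y (D + int n)"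
    by (intro diff sum)
  also have "(\<lambda>x. p n (g x) * inverse (bell_deriv g n n x) -
     (\<Sum>l=n+1..m. ode_coeff p g m l x * (bell_deriv g l n x * inverse (bell_deriv g n n x)))) = ode_coeff p g m n"
    by (rule ext, subst ode_coeff.simps) (simp add: divide_inverse)
  finally show ?thesis .
qed

lemma ode_coeff:
  assumes g: "smooth_beyond b g" "(\<lambda>x. of_real (g x)) \<in> Y s"
    and inv: "(\<lambda>x. inverse (vd (\<lambda>x. complex_of_real (g x)) x)) \<in> Y (1 - s)"
    and p: "\<And>n. n \<in> {k..m} \<Longrightarrow> (\<lambda>x. p n (g x)) \<in> Y (D + s * int n)"
  shows "n \<in> {k..m} \<Longrightarrow> ode_coeff p g m n \<in> Y (D + int n)"
proof (induction "m - n" arbitrary: n rule: less_induct)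
  case (less n)
  show ?case
    by (rule ode_coeff_step[OF g inv p[OF less.prems] less.hyps]) (use less.prems in auto)
qed

end

lemma graded_functions_expandable: "graded_functions (\<lambda>d. {f. expandable d f})"
proof
  show "(\<lambda>x. 0) \<in> {f. expandable d f}" for d
    by (simp add: expandable_def expands_upto_zero)
qed (auto intro: expandable_cong expandable_mono expandable_add expandable_scale expandable_mult
       expandable_vd expandable_const)

lemma ode_coeff_top:
  assumes "smooth_beyond b g"
  shows "\<forall>\<^sub>F x in at_top. ode_coeff p g m m x = p m (g x) / of_real (vd g x) ^ m"
  using eventually_gt_at_top[of b]
  by eventually_elim (subst ode_coeff.simps, use assms in \<open>simp add: smooth_beyond_def bell_deriv_diag\<close>)

section \<open>Strict classes of integer order and composition in class B\<close>

lemma strict_AI: "expandable d f \<Longrightarrow> leading d f c \<Longrightarrow> c \<noteq> 0 \<Longrightarrow> f \<in> strict_A (of_int d)"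
  using strict_A_iff by blast

lemma strict_AE:
  assumes "f \<in> strict_A (of_int d)"
  obtains c where "expandable d f" "leading d f c" "c \<noteq> 0"
  using assms strict_A_iff by blast

lemma strict_A_vd:
  assumes "f \<in> strict_A (of_int d)" "d \<noteq> 0"
  shows "vd f \<in> strict_A (of_int (d - 1))"
  using assms(1)
proof (rule strict_AE)
  fix c assume c: "expandable d f" "leading d f c" "c \<noteq> 0"
  show ?thesis
    by (rule strict_AI[OF expandable_vd[OF c(1)] expandable_leading_vd[OF c(1,2)]]) (use c assms in simp)
qed

lemma strict_A_nonzero: "f \<in> strict_A (of_int d) \<Longrightarrow> \<forall>\<^sub>F x in at_top. f x \<noteq> 0"
  by (erule strict_AE) (rule leading_nonzero)

lemma strict_A_mult:
  assumes "f \<in> strict_A (of_int d)" "h \<in> strict_A (of_int e)"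
  shows "(\<lambda>x. f x * h x) \<in> strict_A (of_int (d + e))"
proof -
  obtain a where a: "expandable d f" "leading d f a" "a \<noteq> 0" using assms(1) by (rule strict_AE)
  obtain c where c: "expandable e h" "leading e h c" "c \<noteq> 0" using assms(2) by (rule strict_AE)
  show ?thesis
    by (rule strict_AI[OF expandable_mult[OF a(1) c(1)] leading_mult[OF a(2) c(2)]]) (simp add: a c)
qed

lemma strict_A_inverse:
  assumes "f \<in> strict_A (of_int d)"
  shows "(\<lambda>x. inverse (f x)) \<in> strict_A (of_int (- d))"
  by (rule strict_AE[OF assms], rule strict_AI[OF expandable_inverse leading_inverse]) auto

lemma strict_A_power:
  assumes "f \<in> strict_A (of_int d)"
  shows "(\<lambda>x. f x ^ n) \<in> strict_A (of_int (int n * d))"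
  by (rule strict_AE[OF assms], rule strict_AI[OF expandable_power_nat leading_power_nat]) auto

lemma strict_A_cong:
  "f \<in> strict_A (of_int d) \<Longrightarrow> \<forall>\<^sub>F x in at_top. f x = h x \<Longrightarrow> h \<in> strict_A (of_int d)"
  using expandable_cong leading_cong unfolding strict_A_iff by blast

text \<open>The top coefficient is a quotient without a sum, so nothing cancels and the order is
  exact; \<open>s \<noteq> 0\<close> keeps the leading coefficient of \<open>g'\<close>
  nonzero.\<close>

lemma strict_A_ode_coeff_top:
  assumes g: "smooth_beyond b g" "(\<lambda>x. of_real (g x)) \<in> strict_A (of_int s)" "s \<noteq> 0"
    and p: "(\<lambda>x. p m (g x)) \<in> strict_A (of_int (s * i))"
  shows "ode_coeff p g m m \<in> strict_A (of_int (s * (i - int m) + int m))"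
proof -
  have "s * i + - (int m * (s - 1)) = s * (i - int m) + int m" by (simp add: algebra_simps)
  then have "(\<lambda>x. p m (g x) * inverse (vd (\<lambda>x. of_real (g x)) x ^ m)) \<in> strict_A (of_int (s * (i - int m) + int m))"
    using strict_A_mult[OF p strict_A_inverse[OF strict_A_power[OF strict_A_vd[OF g(2,3)], of m]]] by metis
  then show ?thesis
  proof (rule strict_A_cong)
    show "\<forall>\<^sub>F x in at_top. p m (g x) * inverse (vd (\<lambda>x. of_real (g x)) x ^ m) = ode_coeff p g m m x"
      using ode_coeff_top[OF g(1), of p m] eventually_gt_at_top[of b]
      by eventually_elim (use g(1) in \<open>simp add: smooth_beyond_def divide_inverse\<close>)
  qed
qed

lemma strict_A_smooth: "f \<in> strict_A (of_int d) \<Longrightarrow> smooth_at_top f"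
  by (erule strict_AE) (auto dest!: expandable_symbol simp: symbol_iff)

text \<open>Class B bounds each order by its index, which is the case \<open>D = 0\<close>. For the
  lower coefficients, expandability at order \<open>k\<close> already leaves only an empty expansion
  or strictness of order at most \<open>k\<close>.\<close>

lemma class_B_compose:
  fixes g :: "real \<Rightarrow> real" and s :: nat
  assumes f: "f \<in> class_B m" and s: "s > 0"
    and g: "(\<lambda>x. of_real (g x)) \<in> strict_A (of_int (int s))" and lim: "filterlim g at_top at_top"
  shows "(\<lambda>x. f (g x)) \<in> class_B m"
proof -
  let ?G = "\<lambda>x. complex_of_real (g x)"
  obtain p i where ode: "solves_ode m p f" and smooth: "smooth_at_top f"
    and pk: "\<And>k. k \<in> {1..<m} \<Longrightarrow> empty_expansion (p k) \<or> (\<exists>i::int. i \<le> int k \<and> p k \<in> strict_A (of_int i))"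
    and pm: "i \<le> int m" "p m \<in> strict_A (of_int i)"
    using f unfolding class_B_def by blast
  obtain b where b: "smooth_beyond b g" using smooth_beyond_exists strict_A_smooth[OF g] by blast
  obtain c where G: "expandable (int s) ?G" and c: "leading (int s) ?G c" "c \<noteq> 0"
    using g by (rule strict_AE)
  have vdG: "vd ?G \<in> strict_A (of_int (int s - 1))"
    by (rule strict_A_vd[OF g]) (use s in simp)
  have nz: "\<forall>\<^sub>F x in at_top. vd g x \<noteq> 0"
    using strict_A_nonzero[OF vdG] eventually_gt_at_top[of b]
    by eventually_elim (use b in \<open>simp add: smooth_beyond_def\<close>)
  have pe: "expandable (int k) (p k)" if "k \<in> {1..m}" for k
  proof -
    have "empty_expansion (p k) \<or> (\<exists>i::int. i \<le> int k \<and> p k \<in> strict_A (of_int i))"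
      using pk[of k] pm that by (cases "k = m") auto
    then show ?thesis
    proof (elim disjE exE conjE)
      fix i assume "i \<le> int k" "p k \<in> strict_A (of_int i)"
      then show ?thesis using expandable_mono[of i "p k" "int k"] unfolding strict_A_iff by blast
    qed (rule empty_expansion_expandable)
  qed
  interpret Y: graded_functions "\<lambda>d. {f. expandable d f}" by (rule graded_functions_expandable)
  have \<pi>: "expandable (int n) (ode_coeff p g m n)" if "n \<in> {1..m}" for n
  proof -
    have "ode_coeff p g m n \<in> {f. expandable (0 + int n) f}"
    proof (rule Y.ode_coeff[OF b])
      show "(\<lambda>x. inverse (vd ?G x)) \<in> {f. expandable (1 - int s) f}"
        using strict_A_inverse[OF vdG] unfolding strict_A_iff by simp
      show "(\<lambda>x. p n (g x)) \<in> {f. expandable (0 + int s * int n) f}" if "n \<in> {1..m}" for n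
        using expandable_compose[OF pe[OF that] G c lim] s by simp
    qed (use that G in auto)
    then show ?thesis by simp
  qed
  obtain a where a: "expandable i (p m)" "leading i (p m) a" "a \<noteq> 0"
    using pm(2) by (rule strict_AE)
  have pmg: "(\<lambda>x. p m (g x)) \<in> strict_A (of_int (int s * i))"
    by (rule strict_AI[OF expandable_compose[OF a(1) G c lim] leading_compose[OF a(2) c lim]])
       (use s a c in simp_all)
  have top: "ode_coeff p g m m \<in> strict_A (of_int (int s * (i - int m) + int m))"
    by (rule strict_A_ode_coeff_top[where p = p and m = m and i = i, OF b g _ pmg]) (use s in simp)
  have le: "int s * (i - int m) + int m \<le> int m"
    using mult_left_mono[OF pm(1), of "int s"] by (simp add: right_diff_distrib)
  have lower: "empty_expansion (ode_coeff p g m k) \<or>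
      (\<exists>i::int. i \<le> int k \<and> ode_coeff p g m k \<in> strict_A (of_int i))" if "k \<in> {1..<m}" for k
  proof -
    have "expandable (int k) (ode_coeff p g m k)" using that by (intro \<pi>) auto
    from expandable_cases[OF this] show ?thesis
    proof (elim disjE exE)
      fix j assume "ode_coeff p g m k \<in> strict_A (of_int (int k - int j))"
      then show ?thesis by (rule disjI2[OF exI[of _ "int k - int j", OF conjI, rotated]]) simp
    qed (rule disjI1)
  qed
  show ?thesis
    unfolding class_B_def mem_Collect_eq
  proof (intro conjI exI[of _ "ode_coeff p g m"] ballI)
    show "smooth_at_top (\<lambda>x. f (g x))" by (rule smooth_at_top_compose[OF smooth b lim])
    show "solves_ode m (ode_coeff p g m) (\<lambda>x. f (g x))" by (rule solves_ode_compose[OF ode b lim nz])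
  qed (use top le lower in blast)+
qed

section \<open>The families X\<close>

context X_family
begin

lemma X_cases:
  assumes "\<alpha> \<in> X (of_int d)"
  shows "ev_zero \<alpha> \<or> (\<exists>j::nat. \<alpha> \<in> strict_X X (of_int (d - int j)))"
proof (cases "ev_zero \<alpha> \<or> \<alpha> \<in> strict_X X (of_int d)")
  case True
  then show ?thesis by (metis diff_zero of_nat_0)
next
  case False
  then obtain k :: nat where "\<alpha> \<in> strict_X X (of_int d - of_nat k)"
    using strict_lower[OF assms] by blast
  then have "\<alpha> \<in> strict_X X (of_int (d - int k))" by simp
  then show ?thesis by blast
qed

text \<open>This turns membership into a bound: membership gives strictness at some
  \<open>d - j\<close>, and the strict order is unique.\<close>

lemma strict_X_order_le:
  assumes "\<alpha> \<in> X (of_int d)" "\<alpha> \<in> strict_X X (of_int r)"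
  shows "r \<le> d"
proof -
  have r: "\<alpha> \<in> strict_A (of_int r)" using assms(2) by (simp add: strict_X_def)
  then obtain j :: nat where "\<alpha> \<in> strict_A (of_int (d - int j))"
    using X_cases[OF assms(1)] strict_A_not_ev_zero unfolding strict_X_def by blast
  from strict_A_order_unique[OF r this] show ?thesis by simp
qed

lemma X_mono: "d \<le> e \<Longrightarrow> X (of_int d) \<subseteq> X (of_int e)"
proof -
  assume "d \<le> e"
  then show ?thesis
  proof (induction e rule: int_ge_induct)
    case (step e)
    then show ?case using nested[of "of_int (e + 1)"] by (auto simp: algebra_simps)
  qed simp
qed

text \<open>The axioms do not by themselves provide an element, so zero is made from a given
  \<open>\<beta>\<close>: scaling by 0 yields it at one order, differentiation moves it down and
  nesting up.\<close>

lemma ev_zero_in_X: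
  assumes "\<beta> \<in> X (of_int s)" "ev_zero \<alpha>"
  shows "\<alpha> \<in> X (of_int d)"
proof -
  have z: "(\<lambda>x. 0) \<in> X (of_int (s - int n))" for n
  proof (induction n)
    case 0
    then show ?case using scale[OF assms(1), of 0] by simp
  next
    case (Suc n)
    have "vd (\<lambda>x::real. 0 :: complex) = (\<lambda>x. 0)" by (simp add: fun_eq_iff)
    then show ?case using deriv[OF Suc] by (simp add: algebra_simps)
  qed
  have "(\<lambda>x. 0) \<in> X (of_int d)"
    by (rule subsetD[OF X_mono z[of "nat (s - d)"]]) simp
  then show ?thesis by (rule germ) (use assms(2) in \<open>auto simp: ev_zero_def elim: eventually_mono\<close>)
qed

lemma one_in_X:
  assumes "\<beta> \<in> strict_X X (of_int s)"
  shows "(\<lambda>x. 1) \<in> X (of_int 0)"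
proof -
  have "(\<lambda>x. \<beta> x / \<beta> x) \<in> X (of_int s - of_int s)"
    using assms by (intro divide) (auto simp: strict_X_def)
  then have "(\<lambda>x. \<beta> x / \<beta> x) \<in> X (of_int 0)" by simp
  then show ?thesis
  proof (rule germ)
    have "\<beta> \<in> strict_A (of_int s)" using assms by (simp add: strict_X_def)
    from strict_A_nonzero[OF this] show "\<forall>\<^sub>F x in at_top. \<beta> x / \<beta> x = 1"
      by eventually_elim simp
  qed
qed

lemma graded_functions_X:
  assumes "\<beta> \<in> strict_X X (of_int s)"
  shows "graded_functions (\<lambda>d. X (of_int d))"
proof
  have \<beta>: "\<beta> \<in> X (of_int s)" using assms by (simp add: strict_X_def)
  show "(\<lambda>x. 0) \<in> X (of_int d)" for d
    by (rule ev_zero_in_X[OF \<beta>]) (simp add: ev_zero_def)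
  show "(\<lambda>x. 1) \<in> X (of_int 0)" by (rule one_in_X[OF assms])
  show "d \<le> e \<Longrightarrow> X (of_int d) \<subseteq> X (of_int e)" for d e by (rule X_mono)
  show "vd f \<in> X (of_int (d - 1))" if "f \<in> X (of_int d)" for f d
    using deriv[OF that] by simp
  show "(\<lambda>x. f x * h x) \<in> X (of_int (d + e))" if "f \<in> X (of_int d)" "h \<in> X (of_int e)" for f h d e
    using mult[OF that] by simp
qed (fact germ add scale)+

lemma ode_compose:
  fixes g :: "real \<Rightarrow> real" and s :: nat and i :: "nat \<Rightarrow> int"
  assumes m: "m \<ge> 1" and ode: "solves_ode m p f"
    and pk: "\<And>k. k \<in> {1..<m} \<Longrightarrow> ev_zero (p k) \<or> p k \<in> strict_X X (of_int (i k))"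
    and pm: "p m \<in> strict_X X (of_int (i m))"
    and s: "s > 0" and g: "(\<lambda>x. of_real (g x)) \<in> strict_X X (of_nat s)"
    and lim: "filterlim g at_top at_top"
  shows "\<exists>(\<pi> :: nat \<Rightarrow> real \<Rightarrow> complex) (r :: nat \<Rightarrow> int).
           solves_ode m \<pi> (\<lambda>x. f (g x)) \<and>
           (\<forall>\<^sub>F x in at_top. \<pi> m x = p m (g x) / of_real (hderiv 1 g x) ^ m) \<and>
           (\<forall>k\<in>{1..<m}. \<forall>\<^sub>F x in at_top.
              \<pi> k x = p k (g x) / bell_deriv g k k x
                - (\<Sum>n=k+1..m. \<pi> n x * (bell_deriv g n k x / bell_deriv g k k x))) \<and>
           (\<forall>k\<in>{1..<m}. ev_zero (\<pi> k) \<or> \<pi> k \<in> strict_X X (of_int (r k))) \<and>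
           \<pi> m \<in> strict_X X (of_int (r m)) \<and>
           r m = int s * (i m - int m) + int m \<and>
           (\<forall>k\<in>{1..<m}. \<not> ev_zero (\<pi> k) \<longrightarrow>
              r k \<le> Max ((if ev_zero (p k) then {} else {int s * (i k - int k)}) \<union>
                         {r n - int n | n. n \<in> {k+1..m} \<and> (n = m \<or> \<not> ev_zero (\<pi> n))})
                    + int k) \<and>
           (\<forall>k\<in>{1..m}. \<not> ev_zero (\<pi> k) \<longrightarrow>
              r k \<le> Max {int s * (i n - int n) | n. n \<in> {k..m} \<and> \<not> ev_zero (p n)} + int k)"
proof -
  let ?G = "\<lambda>x. complex_of_real (g x)"
  let ?\<pi> = "ode_coeff p g m"
  have G: "?G \<in> strict_X X (of_int (int s))" using g by simp
  then have GX: "?G \<in> X (of_int (int s))" and GA: "?G \<in> strict_A (of_int (int s))"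
    by (simp_all add: strict_X_def)
  interpret Y: graded_functions "\<lambda>d. X (of_int d)" by (rule graded_functions_X[OF G])
  obtain b where b: "smooth_beyond b g" using smooth_beyond_exists strict_A_smooth[OF GA] by blast
  have vdG: "vd ?G \<in> strict_A (of_int (int s - 1))"
    by (rule strict_A_vd[OF GA]) (use s in simp)
  have nz: "\<forall>\<^sub>F x in at_top. vd g x \<noteq> 0"
    using strict_A_nonzero[OF vdG] eventually_gt_at_top[of b]
    by eventually_elim (use b in \<open>simp add: smooth_beyond_def\<close>)
  have inv: "(\<lambda>x. inverse (vd ?G x)) \<in> X (of_int (1 - int s))"
  proof -
    have "(\<lambda>x. 1 / vd ?G x) \<in> X (of_int 0 - of_int (int s - 1))"
      by (rule divide[OF Y.one Y.vd[OF GX] vdG])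
    moreover have "of_int 0 - of_int (int s - 1) = (of_int (1 - int s) :: complex)" by simp
    ultimately show ?thesis by (simp only: inverse_eq_divide)
  qed
  have p: "ev_zero (p k) \<or> p k \<in> strict_X X (of_int (i k))" if "k \<in> {1..m}" for k
    using pk[of k] pm that by (cases "k = m") auto
  have comp: "(\<lambda>x. p k (g x)) \<in> strict_X X (of_int (int s * i k))" if "p k \<in> strict_X X (of_int (i k))" for k
    using compose[OF that s g] lim by (simp add: filterlim_at_top_dense)
  \<comment> \<open>A vanishing \<open>p k\<close> stays zero under composition and belongs to every
    order, so it puts no condition on \<open>d\<close>; hence its term is absent from the
    maxima.\<close>
  have pg: "(\<lambda>x. p k (g x)) \<in> X (of_int d)"
    if k: "k \<in> {1..m}" and d: "\<not> ev_zero (p k) \<Longrightarrow> int s * i k \<le> d" for k d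
  proof (cases "ev_zero (p k)")
    case True
    then have "ev_zero (\<lambda>x. p k (g x))"
      unfolding ev_zero_def using lim[unfolded filterlim_iff, rule_format] by blast
    then show ?thesis by (rule ev_zero_in_X[OF GX])
  next
    case False
    with p[OF k] have "(\<lambda>x. p k (g x)) \<in> strict_X X (of_int (int s * i k))" by (intro comp) simp
    then have "(\<lambda>x. p k (g x)) \<in> X (of_int (int s * i k))" unfolding strict_X_def by (rule IntD1)
    then show ?thesis using X_mono[OF d[OF False]] by blast
  qed
  have \<pi>: "?\<pi> n \<in> X (of_int (D + int n))"
    if "\<And>n. n \<in> {k..m} \<Longrightarrow> (\<lambda>x. p n (g x)) \<in> X (of_int (D + int s * int n))" "n \<in> {k..m}" for D k n
    using Y.ode_coeff[OF b GX inv, of k m p D n] that by blast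
  \<comment> \<open>For \<open>k \<le> m\<close>, the least \<open>D\<close> with
    \<open>s * i n \<le> D + s * n\<close> for every nonvanishing \<open>p n\<close> from
    \<open>k\<close> on.\<close>
  define M where "M k = Max {int s * (i n - int n) | n. n \<in> {k..m} \<and> \<not> ev_zero (p n)}" for k
  have \<pi>M: "?\<pi> k \<in> X (of_int (M k + int k))" if k: "k \<in> {1..m}" for k
  proof (rule \<pi>)
    fix n assume n: "n \<in> {k..m}"
    show "(\<lambda>x. p n (g x)) \<in> X (of_int (M k + int s * int n))"
    proof (rule pg)
      assume "\<not> ev_zero (p n)"
      then have "int s * (i n - int n) \<le> M k"
        unfolding M_def using n by (intro Max_ge) auto
      then show "int s * i n \<le> M k + int s * int n" by (simp add: algebra_simps)
    qed (use n k in auto)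
  qed (use k in auto)
  \<comment> \<open>For a vanishing coefficient this value is arbitrary; every claim about
    \<open>r k\<close> is guarded by nonvanishing.\<close>
  define r where "r k = (SOME r. ?\<pi> k \<in> strict_X X (of_int r))" for k
  have r: "?\<pi> k \<in> strict_X X (of_int (r k))" if k: "k \<in> {1..m}" "\<not> ev_zero (?\<pi> k)" for k
    unfolding r_def using X_cases[OF \<pi>M[OF k(1)]] k(2) by (metis someI_ex)
  have r_le: "r k \<le> d" if "k \<in> {1..m}" "\<not> ev_zero (?\<pi> k)" "?\<pi> k \<in> X (of_int d)" for k d
    using strict_X_order_le[OF that(3) r[OF that(1,2)]] .
  have top: "?\<pi> m \<in> strict_A (of_int (int s * (i m - int m) + int m))"
  proof (rule strict_A_ode_coeff_top[OF b GA])
    show "(\<lambda>x. p m (g x)) \<in> strict_A (of_int (int s * i m))"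
      using comp[OF pm] by (simp add: strict_X_def)
  qed (use s in simp)
  have top_nz: "\<not> ev_zero (?\<pi> m)" by (rule strict_A_not_ev_zero[OF top])
  have r_top: "r m = int s * (i m - int m) + int m"
    using strict_A_order_unique[OF _ top] r[OF _ top_nz] m by (simp add: strict_X_def)
  have fine: "r k \<le> Max ((if ev_zero (p k) then {} else {int s * (i k - int k)}) \<union>
       {r n - int n | n. n \<in> {k+1..m} \<and> (n = m \<or> \<not> ev_zero (?\<pi> n))}) + int k"
    (is "_ \<le> Max ?A + _") if k: "k \<in> {1..<m}" and nzk: "\<not> ev_zero (?\<pi> k)" for k
  proof (rule r_le[OF _ nzk])
    \<comment> \<open>Here \<open>D\<close> is the largest excess entering a single step of the
      recursion, with the true orders \<open>r n\<close> of the later coefficients.\<close>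
    let ?D = "Max ?A"
    have fin: "finite ?A" by auto
    show "?\<pi> k \<in> X (of_int (?D + int k))"
    proof (rule Y.ode_coeff_step[OF b GX inv])
      show "(\<lambda>x. p k (g x)) \<in> X (of_int (?D + int s * int k))"
      proof (rule pg)
        assume "\<not> ev_zero (p k)"
        then have "int s * (i k - int k) \<le> ?D" by (intro Max_ge fin) simp
        then show "int s * i k \<le> ?D + int s * int k" by (simp add: algebra_simps)
      qed (use k in auto)
    next
      fix n assume n: "n \<in> {k+1..m}"
      show "?\<pi> n \<in> X (of_int (?D + int n))"
      proof (cases "ev_zero (?\<pi> n)")
        case True
        then show ?thesis by (rule ev_zero_in_X[OF GX])
      next
        case False
        with n have "r n - int n \<le> ?D" by (intro Max_ge fin) blast
        moreover have "?\<pi> n \<in> X (of_int (r n))" using r[OF _ False] n by (simp add: strict_X_def)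
        ultimately show ?thesis using X_mono[of "r n" "?D + int n"] by auto
      qed
    qed
  qed (use k in auto)
  show ?thesis
  proof (intro exI[of _ ?\<pi>] exI[of _ r] conjI ballI impI)
    show "solves_ode m ?\<pi> (\<lambda>x. f (g x))" by (rule solves_ode_compose[OF ode b lim nz])
    show "\<forall>\<^sub>F x in at_top. ?\<pi> m x = p m (g x) / of_real (hderiv 1 g x) ^ m"
      using ode_coeff_top[OF b] by simp
    show "\<forall>\<^sub>F x in at_top. ?\<pi> k x = p k (g x) / bell_deriv g k k x
        - (\<Sum>n=k+1..m. ?\<pi> n x * (bell_deriv g n k x / bell_deriv g k k x))" for k
      by (rule always_eventually, rule allI, rule ode_coeff.simps)
    show "ev_zero (?\<pi> k) \<or> ?\<pi> k \<in> strict_X X (of_int (r k))" if "k \<in> {1..<m}" for k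
      using r[of k] that by auto
    show "?\<pi> m \<in> strict_X X (of_int (r m))" using r[OF _ top_nz] m by simp
    show "r k \<le> Max {int s * (i n - int n) | n. n \<in> {k..m} \<and> \<not> ev_zero (p n)} + int k"
      if "k \<in> {1..m}" "\<not> ev_zero (?\<pi> k)" for k
      using r_le[OF that \<pi>M[OF that(1)]] by (simp add: M_def)
  qed (fact r_top fine)+
qed

end

theorem theorem1p4:
  fixes X :: "complex \<Rightarrow> (real \<Rightarrow> complex) set" and m :: nat
  assumes X: "X_family X" and m: "m \<ge> 1"
  shows
    "(\<forall>(f :: real \<Rightarrow> complex) (p :: nat \<Rightarrow> real \<Rightarrow> complex) (i :: nat \<Rightarrow> int)
        (g :: real \<Rightarrow> real) (s :: nat).
        solves_ode m p f \<longrightarrow>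
        (\<forall>k\<in>{1..<m}. ev_zero (p k) \<or> p k \<in> strict_X X (of_int (i k))) \<longrightarrow>
        p m \<in> strict_X X (of_int (i m)) \<longrightarrow>
        s > 0 \<longrightarrow>
        (\<lambda>x. of_real (g x)) \<in> strict_X X (of_nat s) \<longrightarrow>
        filterlim g at_top at_top \<longrightarrow>
        (\<exists>(\<pi> :: nat \<Rightarrow> real \<Rightarrow> complex) (r :: nat \<Rightarrow> int).
           solves_ode m \<pi> (\<lambda>x. f (g x)) \<and>
           (\<forall>\<^sub>F x in at_top. \<pi> m x = p m (g x) / of_real (hderiv 1 g x) ^ m) \<and>
           (\<forall>k\<in>{1..<m}. \<forall>\<^sub>F x in at_top.
              \<pi> k x = p k (g x) / bell_deriv g k k x
                - (\<Sum>n=k+1..m. \<pi> n x * (bell_deriv g n k x / bell_deriv g k k x))) \<and>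
           (\<forall>k\<in>{1..<m}. ev_zero (\<pi> k) \<or> \<pi> k \<in> strict_X X (of_int (r k))) \<and>
           \<pi> m \<in> strict_X X (of_int (r m)) \<and>
           r m = int s * (i m - int m) + int m \<and>
           (\<forall>k\<in>{1..<m}. \<not> ev_zero (\<pi> k) \<longrightarrow>
              r k \<le> Max ((if ev_zero (p k) then {} else {int s * (i k - int k)}) \<union>
                         {r n - int n | n. n \<in> {k+1..m} \<and> (n = m \<or> \<not> ev_zero (\<pi> n))})
                    + int k) \<and>
           (\<forall>k\<in>{1..m}. \<not> ev_zero (\<pi> k) \<longrightarrow>
              r k \<le> Max {int s * (i n - int n) | n. n \<in> {k..m} \<and> \<not> ev_zero (p n)} + int k)))
     \<and>
     (\<forall>(f :: real \<Rightarrow> complex) (g :: real \<Rightarrow> real) (s :: nat).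
        f \<in> class_B m \<longrightarrow>
        s > 0 \<longrightarrow>
        (\<lambda>x. of_real (g x)) \<in> strict_X X (of_nat s) \<longrightarrow>
        filterlim g at_top at_top \<longrightarrow>
        (\<lambda>x. f (g x)) \<in> class_B m)"
proof (intro conjI allI impI)
  fix f p and i :: "nat \<Rightarrow> int" and g :: "real \<Rightarrow> real" and s :: nat
  assume ode: "solves_ode m p f"
    and pk: "\<forall>k\<in>{1..<m}. ev_zero (p k) \<or> p k \<in> strict_X X (of_int (i k))"
    and pm: "p m \<in> strict_X X (of_int (i m))" and s: "s > 0"
    and g: "(\<lambda>x. of_real (g x)) \<in> strict_X X (of_nat s)" and lim: "filterlim g at_top at_top"
  show "\<exists>\<pi> r. solves_ode m \<pi> (\<lambda>x. f (g x)) \<and>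
           (\<forall>\<^sub>F x in at_top. \<pi> m x = p m (g x) / of_real (hderiv 1 g x) ^ m) \<and>
           (\<forall>k\<in>{1..<m}. \<forall>\<^sub>F x in at_top.
              \<pi> k x = p k (g x) / bell_deriv g k k x
                - (\<Sum>n=k+1..m. \<pi> n x * (bell_deriv g n k x / bell_deriv g k k x))) \<and>
           (\<forall>k\<in>{1..<m}. ev_zero (\<pi> k) \<or> \<pi> k \<in> strict_X X (of_int (r k))) \<and>
           \<pi> m \<in> strict_X X (of_int (r m)) \<and>
           r m = int s * (i m - int m) + int m \<and>
           (\<forall>k\<in>{1..<m}. \<not> ev_zero (\<pi> k) \<longrightarrow>
              r k \<le> Max ((if ev_zero (p k) then {} else {int s * (i k - int k)}) \<union>
                         {r n - int n | n. n \<in> {k+1..m} \<and> (n = m \<or> \<not> ev_zero (\<pi> n))})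
                    + int k) \<and>
           (\<forall>k\<in>{1..m}. \<not> ev_zero (\<pi> k) \<longrightarrow>
              r k \<le> Max {int s * (i n - int n) | n. n \<in> {k..m} \<and> \<not> ev_zero (p n)} + int k)"
  proof (rule X_family.ode_compose[where X = X and m = m and f = f and p = p and i = i and g = g and s = s])
    show "ev_zero (p k) \<or> p k \<in> strict_X X (of_int (i k))" if "k \<in> {1..<m}" for k
      using pk that by blast
  qed (fact X m ode pm s g lim)+
next
  fix f and g :: "real \<Rightarrow> real" and s :: nat
  assume f: "f \<in> class_B m" and s: "s > 0"
    and g: "(\<lambda>x. of_real (g x)) \<in> strict_X X (of_nat s)" and lim: "filterlim g at_top at_top"
  have "(\<lambda>x. of_real (g x)) \<in> strict_A (of_int (int s))"
    using g by (simp add: strict_X_def)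
  from class_B_compose[OF f s this lim] show "(\<lambda>x. f (g x)) \<in> class_B m" .
qed

end
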